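(* Let $P$ be a finite set of points in general position in the plane and let $T$ be a vertex of $G(P)$. Then $T$ is a star (a spanning tree of diameter 2) if and only if every U-clique containing $T$ has exactly 3 elements; that is, for every pair of adjacent vertices $A,B$ of $G(P)$ with $T\in U(A,B)$, we have $|U(A,B)|=3$.
   Context: General position means no three points are collinear. $K(P)$ is the complete geometric graph on $P$ with straight-segment edges; two segments with four distinct endpoints cross if they intersect. An SST is a spanning tree of $K(P)$ no two of whose edges cross; spanning subgraphs are identified with their edge sets. $G(P)$ is the abstract graph whose vertices are the SSTs of $K(P)$, two SSTs $A,B$ being adjacent iff $|A\triangle B|=2$. For adjacent vertices $A,B$ of $G(P)$, the U-clique is $U(A,B)=\{C\in V(G(P)): C\subseteq A\cup B\}$.
   Formalization: The formal theorem assumes that P has at least 3 points; for 1 or 2 points the only spanning tree has diameter 0 or 1, so it is not a star, while the U-clique condition holds vacuously and the equivalence fails. *)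

theory Defs
  imports "HOL-Analysis.Analysis" "HOL-Library.Ramsey"
begin

definition general_position :: "(real^2) set \<Rightarrow> bool" where
  "general_position P \<longleftrightarrow>
     (\<forall>a\<in>P. \<forall>b\<in>P. \<forall>c\<in>P. distinct [a, b, c] \<longrightarrow> \<not> collinear {a, b, c})"

(* An undirected graph on a vertex set P is given by its edge set, a subset of nsets P 2
   (the two-element subsets of P). *)

definition adj_rel :: "'a set set \<Rightarrow> 'a rel" where
  "adj_rel E = {(u, v). {u, v} \<in> E}"

definition graph_connected :: "'a set \<Rightarrow> 'a set set \<Rightarrow> bool" where
  "graph_connected P E \<longleftrightarrow> P \<noteq> {} \<and> (\<forall>u\<in>P. \<forall>v\<in>P. (u, v) \<in> (adj_rel E)\<^sup>*)"

(* A cycle is the list of its distinct vertices in cyclic order; the closing edge joins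
   the last entry to the first. *)
definition is_cycle :: "'a set set \<Rightarrow> 'a list \<Rightarrow> bool" where
  "is_cycle E vs \<longleftrightarrow>
     length vs \<ge> 3 \<and> distinct vs \<and>
     (\<forall>i<length vs. {vs ! i, vs ! (Suc i mod length vs)} \<in> E)"

definition spanning_tree :: "'a set \<Rightarrow> 'a set set \<Rightarrow> bool" where
  "spanning_tree P E \<longleftrightarrow> E \<subseteq> nsets P 2 \<and> graph_connected P E \<and> (\<nexists>vs. is_cycle E vs)"

(* Length of a shortest walk; only meaningful if v is reachable from u. *)
definition graph_dist :: "'a set set \<Rightarrow> 'a \<Rightarrow> 'a \<Rightarrow> nat" where
  "graph_dist E u v = (LEAST k. (u, v) \<in> adj_rel E ^^ k)"

definition graph_diameter :: "'a set \<Rightarrow> 'a set set \<Rightarrow> nat" where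
  "graph_diameter P E = Max {graph_dist E u v | u v. u \<in> P \<and> v \<in> P}"

definition is_star :: "'a set \<Rightarrow> 'a set set \<Rightarrow> bool" where
  "is_star P E \<longleftrightarrow> spanning_tree P E \<and> graph_diameter P E = 2"

definition crosses :: "(real^2) set \<Rightarrow> (real^2) set \<Rightarrow> bool" where
  "crosses e f \<longleftrightarrow>
     (\<exists>a b c d. e = {a, b} \<and> f = {c, d} \<and> distinct [a, b, c, d] \<and>
        closed_segment a b \<inter> closed_segment c d \<noteq> {})"

definition SSTs :: "(real^2) set \<Rightarrow> (real^2) set set set" where
  "SSTs P = {E. spanning_tree P E \<and> (\<forall>e\<in>E. \<forall>f\<in>E. \<not> crosses e f)}"

definition G_adjacent :: "(real^2) set \<Rightarrow> (real^2) set set \<Rightarrow> (real^2) set set \<Rightarrow> bool" where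
  "G_adjacent P A B \<longleftrightarrow> A \<in> SSTs P \<and> B \<in> SSTs P \<and> card (sym_diff A B) = 2"

definition U_clique :: "(real^2) set \<Rightarrow> (real^2) set set \<Rightarrow> (real^2) set set \<Rightarrow> (real^2) set set set" where
  "U_clique P A B = {C \<in> SSTs P. C \<subseteq> A \<union> B}"

end

theory Submission
  imports Defs
begin

text \<open>
  If \<open>A\<close> and \<open>B\<close> are adjacent and \<open>T \<subseteq> A \<union> B\<close>, then \<open>A \<union> B = T + f\<close> contains exactly one cycle, and only
  \<open>f\<close> can be involved in a crossing. For a star the cycle is a triangle, which gives three trees. If
  \<open>T\<close> is not a star, let \<open>b\<close> be the parent of a vertex farthest from some root: all neighbours
  of \<open>b\<close> but one, \<open>c\<close>, are leaves. It suffices to find a leaf \<open>x\<close> at \<open>b\<close> and a vertex \<open>y \<noteq> c\<close> beyond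
  \<open>c\<close> such that the segment \<open>xy\<close> crosses no edge of \<open>T\<close> except possibly \<open>bc\<close>: then \<open>f = xy\<close> closes a
  cycle of length at least 4 through \<open>bc\<close>, and the U-clique of \<open>T\<close> and \<open>T - bc + f\<close> has two elements
  if \<open>f\<close> crosses \<open>bc\<close> and at least four otherwise.

  To find \<open>x\<close> and \<open>y\<close>, prolong a spoke \<open>bx\<close> beyond \<open>x\<close>. If it first hits an edge \<open>pq\<close> at \<open>z\<close>, then
  \<open>c\<close> misses one of the triangles \<open>bzp\<close>, \<open>bzq\<close>, and in that triangle the angularly first vertex \<open>y\<close>
  together with the last leaf before it works. If no spoke is blocked, the same argument in each half
  plane bounded by a spoke shows that \<open>c\<close> is the first vertex there; so every spoke has all vertices
  beyond \<open>c\<close> on one side, and one sees an extreme one of them from the last leaf before \<open>c\<close>.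
\<close>

subsection \<open>Orientation\<close>

text \<open>The sign of the factor \<open>s\<close> selects an orientation: each lemma also covers its mirror image.\<close>
definition turn :: "real \<Rightarrow> real^2 \<Rightarrow> real^2 \<Rightarrow> real^2 \<Rightarrow> real" where
  "turn s a u v = s * ((u - a)$1 * (v - a)$2 - (u - a)$2 * (v - a)$1)"

section \<open>Algebra of the orientation determinant\<close>

lemma turn_self [simp]: "turn s a u u = 0" "turn s a a u = 0" "turn s a u a = 0"
  by (simp_all add: turn_def)

lemma turn_swap: "turn s a v u = - turn s a u v"
  by (simp add: turn_def algebra_simps)

lemma turn_uminus: "turn (- s) a u v = - turn s a u v"
  by (simp add: turn_def)

lemma turn_rotate: "turn s u v a = turn s a u v"
  by (simp add: turn_def algebra_simps)

lemma turn_convex_right: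
  "turn s a u ((1 - k) *\<^sub>R v + k *\<^sub>R w) = (1 - k) * turn s a u v + k * turn s a u w"
  by (simp add: turn_def algebra_simps)

lemma turn_convex_left:
  "turn s a ((1 - k) *\<^sub>R v + k *\<^sub>R w) u = (1 - k) * turn s a v u + k * turn s a w u"
  by (simp add: turn_def algebra_simps)

lemma turn_ray_right: "turn s a u (a + t *\<^sub>R (v - a)) = t * turn s a u v"
  by (simp add: turn_def algebra_simps)

lemma turn_ray_left: "turn s a (a + t *\<^sub>R (v - a)) u = t * turn s a v u"
  by (simp add: turn_def algebra_simps)

text \<open>The three-term Grassmann-Pluecker relation for four plane vectors based at
  \<open>a\<close>.\<close>

lemma turn_plucker:
  "turn s a x u * turn s a v w - turn s a x v * turn s a u w + turn s a x w * turn s a u v = 0"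
  unfolding turn_def by algebra

text \<open>On one side of the line \<open>a x\<close> points are ordered by angle about
  \<open>a\<close>, so no cyclic triple exists: in the Pluecker relation all terms would be
  nonnegative and one positive. Used wherever three angular comparisons contradict each
  other.\<close>

lemma turn_no_cycle:
  assumes "turn s a x u \<ge> 0" "turn s a x v > 0" "turn s a x w \<ge> 0"
    and "turn s a u v \<ge> 0" "turn s a v w \<ge> 0" "turn s a w u > 0"
  shows False
proof -
  have "turn s a x u * turn s a v w + turn s a x v * turn s a w u + turn s a x w * turn s a u v = 0"
    using turn_plucker[of s a x u v w] turn_swap[of s a u w] by simp
  moreover have "turn s a x v * turn s a w u > 0" "turn s a x u * turn s a v w \<ge> 0"
    "turn s a x w * turn s a u v \<ge> 0"
    using assms by simp_all
  ultimately show False by linarith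
qed

text \<open>\<open>t\<close> may have either sign; where the ray itself is meant, the sign of
  \<open>t\<close> is determined separately.\<close>

lemma turn_eq_0_imp_ray:
  assumes "turn s a x m = 0" "s \<noteq> 0" "x \<noteq> a"
  obtains t where "m = a + t *\<^sub>R (x - a)"
proof (cases "(x - a) $ 1 = 0")
  case True
  then have n: "(x - a) $ 2 \<noteq> 0"
    using assms(3) by (auto simp: vec_eq_iff forall_2)
  have "(m - a) $ 1 = 0"
    using assms True n by (simp add: turn_def)
  then have "m = a + ((m - a)$2 / (x - a)$2) *\<^sub>R (x - a)"
    using True n by (auto simp: vec_eq_iff forall_2)
  then show ?thesis by (rule that)
next
  case False
  have "(m - a) $ 2 = (m - a)$1 / (x - a)$1 * (x - a)$2"
    using assms(1,2) False unfolding turn_def by (simp add: field_simps del: right_diff_distrib left_diff_distrib vector_minus_component)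
  then have "m = a + ((m - a)$1 / (x - a)$1) *\<^sub>R (x - a)"
    using False by (auto simp: vec_eq_iff forall_2)
  then show ?thesis by (rule that)
qed

lemma turn_eq_0_imp_collinear:
  assumes "turn 1 a x m = 0"
  shows "collinear {a, x, m}"
proof (cases "x = a")
  case False
  obtain t where "m = a + t *\<^sub>R (x - a)"
    using turn_eq_0_imp_ray[OF assms _ False] by auto
  then have "collinear {x, a, m}"
    by (subst collinear_3) (auto simp: collinear_lemma)
  then show ?thesis by (simp add: insert_commute)
qed simp

lemma convex_in_segment:
  fixes v w :: "'a::real_vector"
  shows "0 \<le> k \<Longrightarrow> k \<le> 1 \<Longrightarrow> (1 - k) *\<^sub>R v + k *\<^sub>R w \<in> closed_segment v w"
  by (auto simp: in_segment)

text \<open>The point at the smallest angle from the ray \<open>a x\<close>. All of \<open>S\<close>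
  lies in an open half plane, where angles can be compared by their cotangents.\<close>

lemma turn_extreme:
  assumes "finite S" "S \<noteq> {}" and pos: "\<And>p. p \<in> S \<Longrightarrow> turn s a x p > 0"
  obtains m where "m \<in> S" "\<And>p. p \<in> S \<Longrightarrow> turn s a m p \<ge> 0"
proof -
  \<comment> \<open>Up to a positive factor, the cotangent of the angle from \<open>a x\<close> to
    \<open>a p\<close>; it decreases as the angle grows.\<close>
  define k where "k p = ((p - a) \<bullet> (x - a)) / turn s a x p" for p
  obtain m where m: "m \<in> S" "\<And>p. p \<in> S \<Longrightarrow> k p \<le> k m"
    using Max_in[of "k ` S"] Max_ge[of "k ` S"] assms(1,2) by (metis (no_types, lifting) finite_imageI image_iff image_is_empty)
  have "turn s a m p \<ge> 0" if p: "p \<in> S" for p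
  proof -
    \<comment> \<open>A Pluecker relation whose fourth vector is \<open>x - a\<close> rotated by a
      quarter turn, which produces the inner products.\<close>
    have "turn s a m p * ((x - a) \<bullet> (x - a))
        = turn s a x p * ((m - a) \<bullet> (x - a)) - turn s a x m * ((p - a) \<bullet> (x - a))"
      unfolding turn_def inner_vec_def sum_2 inner_real_def by algebra
    also have "\<dots> \<ge> 0"
      using m(2)[OF p] pos[OF p] pos[OF m(1)] by (simp add: k_def field_simps)
    finally have "turn s a m p * ((x - a) \<bullet> (x - a)) \<ge> 0" .
    moreover have "(x - a) \<bullet> (x - a) > 0"
      using pos[OF p] by auto
    ultimately show ?thesis
      by (simp add: zero_le_mult_iff)
  qed
  then show ?thesis using m that by blast
qed

subsection \<open>Visibility past a fan of spokes\<close>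

text \<open>
  \<open>X\<close> is the set of leaves at \<open>b\<close>, joined to it by the spokes; \<open>R\<close> and \<open>E\<close> are the vertices and (symmetric)
  edges of the rest of the tree, which hangs on \<open>b\<close> by the edge \<open>bc\<close>. That edge is no obstacle.
\<close>
locale fan =
  fixes b c :: "real^2" and X R :: "(real^2) set" and E :: "((real^2) \<times> (real^2)) set"
  assumes fin: "finite X" "finite R"
    and E_sub: "(v, w) \<in> E \<Longrightarrow> v \<in> R \<and> w \<in> R \<and> v \<noteq> w"
    and E_sym: "(v, w) \<in> E \<Longrightarrow> (w, v) \<in> E"
    and gp: "\<lbrakk>u \<in> insert b (X \<union> R); v \<in> insert b (X \<union> R); w \<in> insert b (X \<union> R); distinct [u, v, w]\<rbrakk>
      \<Longrightarrow> turn 1 u v w \<noteq> 0"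
    and b_notin: "b \<notin> X" "b \<notin> R"
    and disj: "X \<inter> R = {}"
    and c_in: "c \<in> R" and R_big: "R - {c} \<noteq> {}" and X_ne: "X \<noteq> {}"
    and spoke_edge: "\<lbrakk>(v, w) \<in> E; x \<in> X\<rbrakk> \<Longrightarrow> closed_segment v w \<inter> closed_segment b x = {}"
    and edge_edge: "\<lbrakk>(v, w) \<in> E; (p, q) \<in> E; {v, w} \<inter> {p, q} = {}\<rbrakk>
      \<Longrightarrow> closed_segment v w \<inter> closed_segment p q = {}"
begin

section \<open>Meeting points of a segment from a leaf with spokes and edges\<close>

lemma gp_turn:
  assumes "s \<noteq> 0" "u \<in> insert b (X \<union> R)" "v \<in> insert b (X \<union> R)" "w \<in> insert b (X \<union> R)"
    "distinct [u, v, w]"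
  shows "turn s u v w \<noteq> 0"
  using gp[OF assms(2-5)] assms(1) by (simp add: turn_def)

lemma turn_b_nz: "\<lbrakk>s \<noteq> 0; p \<in> X \<union> R; q \<in> X \<union> R; p \<noteq> q\<rbrakk> \<Longrightarrow> turn s b p q \<noteq> 0"
  using b_notin by (intro gp_turn) auto

text \<open>Edges at \<open>y\<close> and the spoke at \<open>x\<close> share an end with
  \<open>x y\<close>, so they do not count for \<open>crosses\<close>. The edge \<open>b c\<close>
  is left out on purpose: it is the one to be removed.\<close>

definition unobstructed :: "real^2 \<Rightarrow> real^2 \<Rightarrow> bool" where
  "unobstructed x y \<longleftrightarrow>
     (\<forall>(v, w)\<in>E. y \<notin> {v, w} \<longrightarrow> closed_segment x y \<inter> closed_segment v w = {}) \<and>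
     (\<forall>x'\<in>X - {x}. closed_segment x y \<inter> closed_segment b x' = {})"

text \<open>Evaluating \<open>turn s b x m\<close> and \<open>turn s b m y\<close> along both
  segments shows that \<open>b x'\<close> points strictly into the angle from \<open>b x\<close> to
  \<open>b y\<close>.\<close>

lemma spoke_crossing:
  assumes "s \<noteq> 0" "x \<in> X" "y \<in> R" "turn s b x y > 0" "x' \<in> X" "x' \<noteq> x"
    and "m \<in> closed_segment x y" "m \<in> closed_segment b x'"
  obtains g where "0 < g" "g \<le> 1" "m = b + g *\<^sub>R (x' - b)"
    "turn s b x x' > 0" "turn s b x' y > 0"
proof -
  obtain k where k: "0 \<le> k" "k \<le> 1" "m = (1 - k) *\<^sub>R x + k *\<^sub>R y"
    using assms(7) by (auto simp: in_segment)
  obtain g where g: "0 \<le> g" "g \<le> 1" "m = (1 - g) *\<^sub>R b + g *\<^sub>R x'"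
    using assms(8) by (auto simp: in_segment)
  have m: "m = b + g *\<^sub>R (x' - b)"
    using g(3) by (simp add: algebra_simps)
  have ne: "x' \<noteq> y" "x \<noteq> y" "x \<noteq> b" "x' \<noteq> b" "y \<noteq> b"
    using assms disj b_notin by auto
  have gpx: "turn s b x x' \<noteq> 0" "turn s b x' y \<noteq> 0"
    using assms ne by (auto simp: gp_turn)
  have 1: "g * turn s b x x' = k * turn s b x y"
    using turn_convex_right[of s b x k x y] turn_ray_right[of s b x g x'] k(3) m by simp
  have 2: "g * turn s b x' y = (1 - k) * turn s b x y"
    using turn_convex_left[of s b k x y y] turn_ray_left[of s b g x' y] k(3) m by simp
  have "g \<noteq> 0"
  proof
    assume "g = 0"
    then have "k * turn s b x y = 0" "(1 - k) * turn s b x y = 0"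
      using 1 2 by auto
    then show False using assms(4) by auto
  qed
  then have g0: "g > 0" using g by simp
  have "turn s b x x' \<ge> 0" "turn s b x' y \<ge> 0"
    using 1 2 g0 k(1,2) assms(4) by (metis zero_le_mult_iff diff_ge_0_iff_ge less_le not_le)+
  then show ?thesis
    using that[OF g0 g(2) m] gpx by auto
qed

text \<open>By general position no end of one segment lies on the line of the other, so the common
  point is interior to both.\<close>

lemma edge_crossing:
  assumes "s \<noteq> 0" "x \<in> X" "y \<in> R" "(v, w) \<in> E" "y \<notin> {v, w}"
    and "m \<in> closed_segment x y" "m \<in> closed_segment v w"
  obtains k g where "0 < k" "k < 1" "m = (1 - k) *\<^sub>R x + k *\<^sub>R y"
    "0 < g" "g < 1" "m = (1 - g) *\<^sub>R v + g *\<^sub>R w"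
proof -
  obtain k where k: "0 \<le> k" "k \<le> 1" "m = (1 - k) *\<^sub>R x + k *\<^sub>R y"
    using assms(6) by (auto simp: in_segment)
  obtain g where g: "0 \<le> g" "g \<le> 1" "m = (1 - g) *\<^sub>R v + g *\<^sub>R w"
    using assms(7) by (auto simp: in_segment)
  have vw: "v \<in> R" "w \<in> R" "v \<noteq> w"
    using E_sub assms(4) by auto
  have ne: "x \<noteq> y" "x \<noteq> v" "x \<noteq> w" "v \<noteq> y" "w \<noteq> y"
    using assms vw disj by auto
  have n: "turn 1 v w x \<noteq> 0" "turn 1 v w y \<noteq> 0" "turn 1 x y v \<noteq> 0" "turn 1 x y w \<noteq> 0"
    using assms vw ne by (auto simp: gp_turn)
  have "turn 1 v w m = 0"
    using turn_convex_right[of 1 v w g v w] g(3) by simp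
  then have 1: "(1 - k) * turn 1 v w x + k * turn 1 v w y = 0"
    using turn_convex_right[of 1 v w k x y] k(3) by simp
  have "turn 1 x y m = 0"
    using turn_convex_right[of 1 x y k x y] k(3) by simp
  then have 2: "(1 - g) * turn 1 x y v + g * turn 1 x y w = 0"
    using turn_convex_right[of 1 x y g v w] g(3) by simp
  have "k \<noteq> 0" "k \<noteq> 1" using 1 n by auto
  moreover have "g \<noteq> 0" "g \<noteq> 1" using 2 n by auto
  ultimately show ?thesis using that[of k g] k g by auto
qed

text \<open>
  The last two assumptions forbid an edge to leave the region \<open>K\<close> in the direction of decreasing angle.
  They mention a subset \<open>J\<close> because the blocking edge \<open>pq\<close> bounding the triangle below leaves it that way.
\<close>
lemma first_unobstructed:
  assumes s: "s \<noteq> 0" and x0: "x0 \<in> X" "x0 \<in> K" and y: "y \<in> R" "y \<in> K" "turn s b x0 y > 0"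
    and side: "\<And>p. p \<in> K \<Longrightarrow> turn s b x0 p \<ge> 0"
    and first: "\<And>r. r \<in> R \<inter> K \<Longrightarrow> turn s b y r \<ge> 0"
    and opn: "\<And>x z k. \<lbrakk>x \<in> X \<inter> K; z \<in> R \<inter> K; 0 < k; k < 1\<rbrakk> \<Longrightarrow> (1 - k) *\<^sub>R x + k *\<^sub>R z \<in> J"
    and JK: "J \<subseteq> K"
    and spokes: "\<And>x g. \<lbrakk>x \<in> X; 0 < g; g \<le> 1; b + g *\<^sub>R (x - b) \<in> K\<rbrakk> \<Longrightarrow> x \<in> K"
    and edges: "\<And>v w g. \<lbrakk>(v, w) \<in> E; 0 < g; g < 1; (1 - g) *\<^sub>R v + g *\<^sub>R w \<in> J; turn s b v w > 0\<rbrakk>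
       \<Longrightarrow> v \<in> K"
  shows "\<exists>x\<in>X. unobstructed x y"
proof -
  \<comment> \<open>Contains \<open>x0\<close>. The reversed sign in \<open>turn_extreme\<close>
    picks the angularly last element, the closest leaf before \<open>y\<close>.\<close>
  define X' where "X' = {x \<in> X \<inter> K. turn s b x y > 0}"
  have "finite X'" "X' \<noteq> {}" "\<And>p. p \<in> X' \<Longrightarrow> turn (- s) b y p > 0"
    using fin x0 y by (auto simp: X'_def turn_uminus turn_swap[of s b _ y])
  then obtain x where x: "x \<in> X'" and last: "\<And>p. p \<in> X' \<Longrightarrow> turn (- s) b x p \<ge> 0"
    using turn_extreme[of X' "- s" b y] by metis
  have xX: "x \<in> X" "x \<in> K" "turn s b x y > 0"
    using x by (auto simp: X'_def)
  have spoke: "closed_segment x y \<inter> closed_segment b x' = {}" if x': "x' \<in> X" "x' \<noteq> x" for x'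
  proof (rule ccontr)
    assume "closed_segment x y \<inter> closed_segment b x' \<noteq> {}"
    then obtain m where m: "m \<in> closed_segment x y" "m \<in> closed_segment b x'"
      by auto
    obtain g where g: "0 < g" "g \<le> 1" "m = b + g *\<^sub>R (x' - b)"
      "turn s b x x' > 0" "turn s b x' y > 0"
      using spoke_crossing[OF s xX(1) y(1) xX(3) x' m] by blast
    have "m \<in> K"
    proof -
      obtain k where k: "0 \<le> k" "k \<le> 1" "m = (1 - k) *\<^sub>R x + k *\<^sub>R y"
        using m(1) by (auto simp: in_segment)
      show ?thesis
      proof (cases "k = 0 \<or> k = 1")
        case True
        then show ?thesis using k xX y by auto
      next
        case False
        then show ?thesis using opn[of x y k] k xX y JK by auto
      qed
    qed
    then have "x' \<in> X'"
      using spokes[of x' g] g x' by (auto simp: X'_def)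
    then show False
      using last[of x'] g by (simp add: turn_uminus)
  qed
  \<comment> \<open>By symmetry of \<open>E\<close>, \<open>v\<close> may be taken as the angularly
    earlier end. Then \<open>v\<close> is in \<open>K\<close> and not before \<open>y\<close>,
    whereas \<open>m\<close> is after \<open>v\<close> and yet before \<open>y\<close>.\<close>
  have no_edge: False if E: "(v, w) \<in> E" and nin: "y \<notin> {v, w}" and m: "m \<in> closed_segment x y" "m \<in> closed_segment v w"
    and pos: "turn s b v w > 0" for v w m
  proof -
    obtain k g where k: "0 < k" "k < 1" "m = (1 - k) *\<^sub>R x + k *\<^sub>R y"
      and g: "0 < g" "g < 1" "m = (1 - g) *\<^sub>R v + g *\<^sub>R w"
      using edge_crossing[OF s xX(1) y(1) E nin m] by metis
    have mJ: "m \<in> J" using opn[of x y k] xX y k by auto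
    have vK: "v \<in> K" using edges[OF E g(1,2)] mJ g(3) pos by simp
    have v: "v \<in> R" using E_sub[OF E] by simp
    have 1: "turn s b v m > 0"
      using turn_convex_right[of s b v g v w] g pos by simp
    have 2: "turn s b m y > 0"
      using turn_convex_left[of s b k x y y] k xX by simp
    have 3: "turn s b y v \<ge> 0"
      using first v vK by auto
    show False
      using turn_no_cycle[of s b x0 m y v] side[of m] mJ JK y(3) side[OF vK] 1 2 3 by auto
  qed
  have edge: "closed_segment x y \<inter> closed_segment v w = {}" if "(v, w) \<in> E" "y \<notin> {v, w}" for v w
  proof (rule ccontr)
    assume "closed_segment x y \<inter> closed_segment v w \<noteq> {}"
    then obtain m where m: "m \<in> closed_segment x y" "m \<in> closed_segment v w"
      by auto
    have vw: "v \<in> R" "w \<in> R" "v \<noteq> w" using E_sub that by auto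
    then have "turn s b v w \<noteq> 0" using s by (simp add: turn_b_nz)
    moreover have "m \<in> closed_segment w v" using m by (simp add: closed_segment_commute)
    ultimately show False
      using no_edge[OF that m] no_edge[of w v m] that E_sym m turn_swap[of s b v w] by force
  qed
  show ?thesis
    using xX spoke edge unfolding unobstructed_def by blast
qed

text \<open>\<open>first_unobstructed\<close> is applied to the closed half plane. An edge entering
  it with increasing angle crosses its boundary on the side of \<open>x\<close>, hence on the spoke
  or on its prolongation, and both are free of edges.\<close>

lemma half_plane:
  assumes s: "s \<noteq> 0" and x: "x \<in> X"
    and free: "\<And>v w t. \<lbrakk>(v, w) \<in> E; t > 1\<rbrakk> \<Longrightarrow> b + t *\<^sub>R (x - b) \<notin> closed_segment v w"
    and y: "y \<in> R" "turn s b x y > 0"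
    and first: "\<And>r. \<lbrakk>r \<in> R; turn s b x r > 0\<rbrakk> \<Longrightarrow> turn s b y r \<ge> 0"
  shows "\<exists>x\<in>X. unobstructed x y"
proof (rule first_unobstructed[where K = "{p. turn s b x p \<ge> 0}" and J = "{p. turn s b x p \<ge> 0}" and ?x0.0 = x])
  have nz: "turn s b x p \<noteq> 0" if "p \<in> R" for p
    using that s x disj by (metis turn_b_nz UnCI disjoint_iff)
  show "turn s b y r \<ge> 0" if "r \<in> R \<inter> {p. turn s b x p \<ge> 0}" for r
    using that first[of r] nz[of r] by auto
  show "x' \<in> {p. turn s b x p \<ge> 0}" if "b + g *\<^sub>R (x' - b) \<in> {p. turn s b x p \<ge> 0}" "0 < g" for x' g
    using that by (auto simp: turn_ray_right zero_le_mult_iff)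
  show "v \<in> {p. turn s b x p \<ge> 0}"
    if E: "(v, w) \<in> E" and g: "0 < g" "g < 1" "(1 - g) *\<^sub>R v + g *\<^sub>R w \<in> {p. turn s b x p \<ge> 0}"
      and pos: "turn s b v w > 0" for v w g
  proof (rule ccontr)
    assume "v \<notin> {p. turn s b x p \<ge> 0}"
    then have neg: "turn s b x v < 0" by auto
    have "(1 - g) * turn s b x v + g * turn s b x w \<ge> 0"
      using g(3) by (simp add: turn_convex_right)
    moreover have "(1 - g) * turn s b x v < 0"
      using neg g by (simp add: mult_less_0_iff)
    ultimately have "g * turn s b x w > 0" by linarith
    then have w0: "turn s b x w > 0" using g by (simp add: zero_less_mult_iff)
    \<comment> \<open>The parameter at which \<open>v w\<close> crosses the line \<open>b x\<close>,
      where \<open>turn s b x\<close> vanishes.\<close>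
    define d where "d = - turn s b x v / (turn s b x w - turn s b x v)"
    define m where "m = (1 - d) *\<^sub>R v + d *\<^sub>R w"
    have d: "0 < d" "d < 1" using neg w0 by (auto simp: d_def field_simps)
    have "turn s b x m = 0"
      unfolding m_def turn_convex_right d_def using neg w0 by (simp add: field_simps)
    then obtain t where t: "m = b + t *\<^sub>R (x - b)"
      using turn_eq_0_imp_ray[of s b x m] s x b_notin by metis
    \<comment> \<open>\<open>turn s b v m\<close>, read along the line and along the edge, puts
      \<open>m\<close> on the ray from \<open>b\<close> towards \<open>x\<close>.\<close>
    have "t * turn s b v x = d * turn s b v w"
      using turn_convex_right[of s b v d v w] turn_ray_right[of s b v t x] t m_def by simp
    moreover have "d * turn s b v w > 0" "turn s b v x > 0"
      using d pos neg turn_swap[of s b x v] by auto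
    ultimately have "t > 0" by (metis zero_less_mult_pos2)
    have mE: "m \<in> closed_segment v w"
      using d unfolding m_def by (intro convex_in_segment) auto
    show False
    proof (cases "t \<le> 1")
      case True
      then have "m \<in> closed_segment b x"
        using \<open>t > 0\<close> t unfolding in_segment by (intro exI[of _ t]) (auto simp: algebra_simps)
      then show False using spoke_edge[OF E x] mE by auto
    next
      case False
      then show False using free[OF E, of t] mE t by auto
    qed
  qed
qed (use assms in \<open>auto simp: turn_convex_right add_nonneg_nonneg\<close>)

text \<open>Let \<open>z\<close> be the first hit of the prolonged spoke; \<open>c\<close> is
  assumed outside the triangle \<open>b z p\<close>. An edge entering the triangle with increasing
  angle would cross \<open>b z\<close>, which consists of the spoke and a stretch free of edges, or
  the edge \<open>p q\<close>.\<close>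

lemma triangle:
  assumes s: "s \<noteq> 0" and x: "x \<in> X"
    and pq: "(p, q) \<in> E" and p0: "turn s b x p > 0"
    and t: "t > 1" "b + t *\<^sub>R (x - b) \<in> closed_segment p q"
    and nearest: "\<And>v w u. \<lbrakk>(v, w) \<in> E; u > 1; b + u *\<^sub>R (x - b) \<in> closed_segment v w\<rbrakk> \<Longrightarrow> t \<le> u"
    and c: "turn s b x c < 0 \<or> turn s b c p < 0 \<or> turn s q p c < 0"
  shows "\<exists>x\<in>X. \<exists>y\<in>R - {c}. unobstructed x y"
proof -
  \<comment> \<open>The closed triangle \<open>b z p\<close>: a wedge at \<open>b\<close>, cut off
    by the line \<open>p q\<close>. \<open>J\<close> omits the points on that line.\<close>
  define K where "K = {m. turn s b x m \<ge> 0 \<and> turn s b m p \<ge> 0 \<and> turn s q p m \<ge> 0}"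
  define J where "J = {m \<in> K. turn s q p m > 0}"
  define z where "z = b + t *\<^sub>R (x - b)"
  have R: "p \<in> R" "q \<in> R" "p \<noteq> q"
    using E_sub[OF pq] by auto
  obtain l where l: "0 \<le> l" "l \<le> 1" "z = (1 - l) *\<^sub>R p + l *\<^sub>R q"
    using t(2) by (auto simp: in_segment z_def)
  have "t * turn s b x p = l * turn s b q p"
    using turn_convex_left[of s b l p q p] turn_ray_left[of s b t x p] l(3) z_def by simp
  moreover have "t * turn s b x p > 0" using t p0 by simp
  ultimately have qp: "turn s b q p > 0" and l0: "l > 0"
    using l(1) by (auto simp: zero_less_mult_iff)
  have "turn s b x z = 0" by (simp add: z_def turn_ray_right)
  then have "(1 - l) * turn s b x p + l * turn s b x q = 0"
    using l(3) turn_convex_right[of s b x l p q] by simp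
  then have "l * turn s b x q \<le> 0"
    using l p0 by (smt (verit) mult_nonneg_nonneg)
  moreover have "turn s b x q \<noteq> 0"
    using turn_b_nz[of s x q] s x R disj by auto
  ultimately have q0: "turn s b x q < 0"
    using l0 by (auto simp: mult_le_0_iff)
  have Lb: "turn s q p b > 0"
    using qp turn_rotate[of s q p b] by simp
  \<comment> \<open>An affine function of \<open>u\<close> that vanishes at \<open>z\<close>, that
    is at \<open>u = t\<close>.\<close>
  have ray: "turn s q p (b + u *\<^sub>R (x - b)) = (1 - u / t) * turn s q p b" for u
  proof -
    have "turn s q p z = 0"
      using l(3) turn_convex_right[of s q p l p q] by simp
    moreover have "z = (1 - t) *\<^sub>R b + t *\<^sub>R x"
      by (simp add: z_def algebra_simps)
    ultimately have "(1 - t) * turn s q p b + t * turn s q p x = 0"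
      using turn_convex_right[of s q p t b x] by simp
    then have 1: "turn s q p x = - (1 - t) / t * turn s q p b"
      using t by (simp add: field_simps)
    have "b + u *\<^sub>R (x - b) = (1 - u) *\<^sub>R b + u *\<^sub>R x"
      by (simp add: algebra_simps)
    then have "turn s q p (b + u *\<^sub>R (x - b)) = (1 - u) * turn s q p b + u * turn s q p x"
      using turn_convex_right[of s q p u b x] by simp
    also have "\<dots> = (1 - u / t) * turn s q p b"
      unfolding 1 using t by (simp add: field_simps)
    finally show ?thesis .
  qed
  \<comment> \<open>The wedge cuts the line \<open>p q\<close> in the segment from \<open>p\<close>
    to \<open>z\<close>, a part of the edge.\<close>
  have hit: "m \<in> closed_segment p q" if m: "turn s b x m \<ge> 0" "turn s b m p \<ge> 0" "turn s q p m = 0" for m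
  proof -
    have "turn s p q m = 0"
      using m(3) turn_rotate[of s p q m] turn_rotate[of s q p m] turn_swap[of s m q p] by simp
    then obtain k where k: "m = p + k *\<^sub>R (q - p)"
      using turn_eq_0_imp_ray[of s p q m] s R by metis
    then have m': "m = (1 - k) *\<^sub>R p + k *\<^sub>R q"
      by (simp add: algebra_simps)
    have "k * turn s b q p \<ge> 0"
      using m(2) turn_convex_left[of s b k p q p] m' by simp
    then have "k \<ge> 0" using qp by (simp add: zero_le_mult_iff)
    have "(1 - k) * turn s b x p + k * turn s b x q \<ge> 0"
      using m(1) turn_convex_right[of s b x k p q] m' by simp
    moreover have "k * turn s b x q \<le> 0"
      using \<open>k \<ge> 0\<close> q0 by (simp add: mult_le_0_iff)
    ultimately have "(1 - k) * turn s b x p \<ge> 0" by linarith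
    then have "k \<le> 1" using p0 by (simp add: zero_le_mult_iff)
    then show ?thesis using \<open>k \<ge> 0\<close> m' by (auto simp: in_segment)
  qed
  have xz: "turn s q p x > 0"
    using ray[of 1] t Lb by simp
  have xK: "x \<in> K"
    using xz p0 by (simp add: K_def)
  have pK: "p \<in> K"
    using p0 by (simp add: K_def)
  have Kpos: "turn s b x r > 0" if "r \<in> R \<inter> K" for r
    using that turn_b_nz[of s x r] s x disj by (auto simp: K_def less_le)
  obtain y where y: "y \<in> R \<inter> K" and first: "\<And>r. r \<in> R \<inter> K \<Longrightarrow> turn s b y r \<ge> 0"
    using turn_extreme[of "R \<inter> K" s b x] fin pK R Kpos by (metis IntI empty_iff finite_Int)
  have "y \<noteq> c"
    using y c by (auto simp: K_def)
  have "\<exists>x\<in>X. unobstructed x y"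
  proof (rule first_unobstructed[where K = K and J = J and ?x0.0 = x])
    show "(1 - k) *\<^sub>R x' + k *\<^sub>R r \<in> J" if "x' \<in> X \<inter> K" "r \<in> R \<inter> K" "0 < k" "k < 1" for x' r k
    proof -
      \<comment> \<open>General position keeps leaves off the line \<open>p q\<close>, so the open
        segment to \<open>r\<close> stays in \<open>J\<close> even if \<open>r\<close> is on that
        line.\<close>
      have "turn s q p x' \<noteq> 0"
        using that s R disj by (intro gp_turn) auto
      then have "turn s q p x' > 0"
        using that by (simp add: K_def)
      then have "turn s q p ((1 - k) *\<^sub>R x' + k *\<^sub>R r) > 0"
        using that by (auto simp: K_def turn_convex_right intro!: add_pos_nonneg)
      then show ?thesis
        using that by (simp add: J_def K_def turn_convex_right turn_convex_left)
    qed
    show "x' \<in> K" if "x' \<in> X" "0 < g" "g \<le> 1" and gK: "b + g *\<^sub>R (x' - b) \<in> K" for x' g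
    proof -
      have 1: "turn s b x x' \<ge> 0" "turn s b x' p \<ge> 0"
        using gK that by (auto simp: K_def turn_ray_right turn_ray_left zero_le_mult_iff)
      have "turn s q p x' \<ge> 0"
      proof (rule ccontr)
        assume "\<not> turn s q p x' \<ge> 0"
        then have n: "turn s q p x' < 0" by simp
        \<comment> \<open>The spoke would leave the triangle through the edge \<open>p q\<close>, at
          the point \<open>m\<close> below.\<close>
        define d where "d = turn s q p b / (turn s q p b - turn s q p x')"
        define m where "m = (1 - d) *\<^sub>R b + d *\<^sub>R x'"
        have d: "0 < d" "d < 1" using n Lb by (auto simp: d_def field_simps)
        have "turn s q p m = 0"
          unfolding m_def turn_convex_right d_def using n Lb by (simp add: field_simps)
        moreover have "turn s b x m \<ge> 0" "turn s b m p \<ge> 0"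
          using 1 d by (simp_all add: m_def turn_convex_right turn_convex_left)
        ultimately have "m \<in> closed_segment p q" using hit by blast
        moreover have "m \<in> closed_segment b x'"
          using d unfolding m_def by (intro convex_in_segment) auto
        ultimately show False using spoke_edge[OF pq that(1)] by auto
      qed
      then show ?thesis using 1 by (simp add: K_def)
    qed
    show "v \<in> K" if E: "(v, w) \<in> E" and g: "0 < g" "g < 1" and J: "(1 - g) *\<^sub>R v + g *\<^sub>R w \<in> J"
        and pos: "turn s b v w > 0" for v w g
    proof -
      define a where "a = (1 - g) *\<^sub>R v + g *\<^sub>R w"
      have a: "turn s b x a \<ge> 0" "turn s b a p \<ge> 0" "turn s q p a > 0"
        using J by (auto simp: J_def K_def a_def)
      have va: "turn s b v a > 0"
        using g pos by (simp add: a_def turn_convex_right)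
      have vaE: "closed_segment v a \<subseteq> closed_segment v w"
        using g convex_in_segment[of g v w] by (simp add: a_def subset_closed_segment)
      have La: "turn s q p a = (1 - g) * turn s q p v + g * turn s q p w"
        by (simp add: a_def turn_convex_right)
      \<comment> \<open>A point \<open>m\<close> of the wedge on or beyond the line
        \<open>p q\<close> forces \<open>v a\<close> to meet the edge \<open>p q\<close>, so the two
        edges share an end. But \<open>w\<close> is strictly on the side of \<open>b\<close>, and
        \<open>v = q\<close> would give \<open>m = q\<close>, outside the wedge.\<close>
      have no_exit: False
        if m: "m \<in> closed_segment v a" "turn s b x m \<ge> 0" "turn s b m p \<ge> 0" "turn s q p m \<le> 0" and vp: "v \<noteq> p" for m
      proof -
        define d where "d = turn s q p a / (turn s q p a - turn s q p m)"
        define m2 where "m2 = (1 - d) *\<^sub>R a + d *\<^sub>R m"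
        have d: "0 < d" "d \<le> 1" using m a by (auto simp: d_def field_simps)
        have "turn s q p m2 = 0"
          unfolding m2_def turn_convex_right d_def using m a by (simp add: field_simps)
        moreover have "turn s b x m2 \<ge> 0" "turn s b m2 p \<ge> 0"
          using m a d by (simp_all add: m2_def turn_convex_right turn_convex_left)
        ultimately have "m2 \<in> closed_segment p q" using hit by blast
        moreover have "m2 \<in> closed_segment a m"
          using d unfolding m2_def by (intro convex_in_segment) auto
        then have "m2 \<in> closed_segment v w"
          using vaE m(1) by (metis (no_types) closed_segment_commute ends_in_segment(2) subset_closed_segment subsetD)
        ultimately have share: "{v, w} \<inter> {p, q} \<noteq> {}"
          using edge_edge[OF E pq] by auto
        obtain e where e: "0 \<le> e" "e \<le> 1" "m = (1 - e) *\<^sub>R v + e *\<^sub>R a"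
          using m(1) by (auto simp: in_segment)
        have Lm: "(1 - e) * turn s q p v + e * turn s q p a \<le> 0"
          using m(4) e(3) turn_convex_right[of s q p e v a] by simp
        have Lv: "turn s q p v \<le> 0"
        proof (rule ccontr)
          assume "\<not> turn s q p v \<le> 0"
          then have "(1 - e) * turn s q p v + e * turn s q p a > 0"
            using e(1,2) a(3) by (cases "e = 0") (auto intro!: add_nonneg_pos)
          then show False using Lm by simp
        qed
        have "v \<noteq> q"
        proof
          assume "v = q"
          then have "e * turn s q p a \<le> 0" using Lm by simp
          then have "e = 0" using e(1) a(3) by (simp add: mult_le_0_iff)
          then show False using m(2) q0 e(3) \<open>v = q\<close> by simp
        qed
        moreover have "w \<noteq> p" "w \<noteq> q"
        proof -
          have "turn s q p w \<noteq> 0"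
          proof
            assume "turn s q p w = 0"
            then have "(1 - g) * turn s q p v > 0" using La a(3) by simp
            then show False using Lv g by (simp add: zero_less_mult_iff)
          qed
          then show "w \<noteq> p" "w \<noteq> q" by auto
        qed
        ultimately show False using vp share by auto
      qed
      show "v \<in> K"
      proof (rule ccontr)
        assume vK: "v \<notin> K"
        then have vp: "v \<noteq> p" using pK by auto
        show False
        proof (cases "turn s b x v \<ge> 0")
          case True
          then have "turn s b v p \<ge> 0"
            using turn_no_cycle[of s b x a p v] a p0 va turn_swap[of s b v p] by force
          moreover from this have "turn s q p v < 0"
            using vK True by (auto simp: K_def)
          ultimately show False using no_exit[of v] True vp by simp
        next
          case False
          \<comment> \<open>\<open>v a\<close> crosses the line \<open>b x\<close> at
            \<open>m\<close>: on the spoke, or on its prolongation no earlier than \<open>z\<close>,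
            hence on or beyond the line \<open>p q\<close>.\<close>
          define d where "d = - turn s b x v / (turn s b x a - turn s b x v)"
          define m where "m = (1 - d) *\<^sub>R v + d *\<^sub>R a"
          have d: "0 < d" "d \<le> 1" using False a by (auto simp: d_def field_simps)
          have xm: "turn s b x m = 0"
            unfolding m_def turn_convex_right d_def using False a by (simp add: field_simps)
          then obtain u where u: "m = b + u *\<^sub>R (x - b)"
            using turn_eq_0_imp_ray[of s b x m] s x b_notin by metis
          have "u * turn s b v x = d * turn s b v a"
            using turn_convex_right[of s b v d v a] turn_ray_right[of s b v u x] u m_def by simp
          moreover have "d * turn s b v a > 0" "turn s b v x > 0"
            using d va False turn_swap[of s b x v] by auto
          ultimately have "u > 0" by (metis zero_less_mult_pos2)
          have ma: "m \<in> closed_segment v a"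
            using d unfolding m_def by (intro convex_in_segment) auto
          then have mE: "m \<in> closed_segment v w" using vaE by auto
          show False
          proof (cases "u \<le> 1")
            case True
            then have "m \<in> closed_segment b x"
              using \<open>u > 0\<close> u unfolding in_segment by (intro exI[of _ u]) (auto simp: algebra_simps)
            then show False using spoke_edge[OF E x] mE by auto
          next
            case False
            then have "t \<le> u" using nearest[OF E, of u] mE u by simp
            then have "turn s q p m \<le> 0"
              using ray[of u] u t Lb by (simp add: mult_le_0_iff)
            moreover have "turn s b m p \<ge> 0"
              using turn_ray_left[of s b u x p] u \<open>u > 0\<close> p0 by simp
            ultimately show False using no_exit[OF ma] xm vp by simp
          qed
        qed
      qed
    qed
  qed (use assms y Kpos first xK in \<open>auto simp: K_def J_def\<close>)
  then show ?thesis using y \<open>y \<noteq> c\<close> by auto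
qed

text \<open>The union of the finitely many edges is closed, so a nearest hit exists. Its edge has an
  end on each side of the line \<open>b x\<close>; the triangle on the side away from
  \<open>c\<close> is used.\<close>

lemma ray_blocked:
  assumes x: "x \<in> X" and hit: "(v, w) \<in> E" "t > 1" "b + t *\<^sub>R (x - b) \<in> closed_segment v w"
  shows "\<exists>x\<in>X. \<exists>y\<in>R - {c}. unobstructed x y"
proof -
  define Z where "Z = (\<Union>(v, w)\<in>E. closed_segment v w)"
  have "finite E"
    using fin E_sub by (intro finite_subset[of E "R \<times> R"]) auto
  then have "closed Z"
    by (auto simp: Z_def)
  \<comment> \<open>Including the parameter 1 makes \<open>S\<close> closed; 1 is no hit, because
    \<open>x\<close> lies on its spoke, which no edge meets.\<close>
  define S where "S = {t. b + t *\<^sub>R (x - b) \<in> Z} \<inter> {1..}"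
  have "closed S"
    unfolding S_def
    by (intro closed_Int continuous_closed_vimage[OF \<open>closed Z\<close>, unfolded vimage_def] closed_atLeast)
      (auto intro!: continuous_intros)
  have "t \<in> S" using hit by (auto simp: S_def Z_def)
  have "bdd_below S" by (auto simp: S_def)
  define u where "u = Inf S"
  have "u \<in> S"
    using closed_contains_Inf[OF _ \<open>bdd_below S\<close> \<open>closed S\<close>] \<open>t \<in> S\<close> by (auto simp: u_def)
  then obtain p q where pq: "(p, q) \<in> E" "b + u *\<^sub>R (x - b) \<in> closed_segment p q" and "u \<ge> 1"
    by (auto simp: S_def Z_def)
  have "u \<noteq> 1"
    using spoke_edge[OF pq(1) x] pq(2) by auto
  then have "u > 1" using \<open>u \<ge> 1\<close> by simp
  have nearest: "u \<le> t'" if "(v, w) \<in> E" "t' > 1" "b + t' *\<^sub>R (x - b) \<in> closed_segment v w" for v w t'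
    using that \<open>bdd_below S\<close> by (auto simp: u_def S_def Z_def intro!: cInf_lower)
  have R: "p \<in> R" "q \<in> R" using E_sub pq by auto
  \<comment> \<open>Puts \<open>p\<close> on the positive side; \<open>- s\<close> then serves for
    \<open>q\<close>.\<close>
  define s :: real where "s = sgn (turn 1 b x p)"
  have s0: "s \<noteq> 0"
    using turn_b_nz[of 1 x p] x R disj by (auto simp: s_def sgn_zero_iff)
  have sp: "turn s b x p > 0"
    using s0 by (auto simp: s_def turn_def sgn_if split: if_splits)
  have uq: "b + u *\<^sub>R (x - b) \<in> closed_segment q p" using pq by (simp add: closed_segment_commute)
  obtain l where l: "0 \<le> l" "l \<le> 1" "b + u *\<^sub>R (x - b) = (1 - l) *\<^sub>R p + l *\<^sub>R q"
    using pq(2) by (auto simp: in_segment)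
  have "(1 - l) * turn s b x p + l * turn s b x q = 0"
    using turn_convex_right[of s b x l p q] turn_ray_right[of s b x u x] l(3) by simp
  moreover have "turn s b x q \<noteq> 0"
    using turn_b_nz[of s x q] s0 x R disj by auto
  ultimately have sq: "turn (- s) b x q > 0"
    using sp l(1,2) by (smt (verit) mult_nonneg_nonneg mult_pos_pos turn_uminus)
  have "turn s b x c \<noteq> 0"
    using turn_b_nz[of s x c] s0 x c_in disj by auto
  then consider "turn s b x c < 0" | "turn s b x c > 0"
    by linarith
  then show ?thesis
  proof cases
    case 1
    then show ?thesis
      by (intro triangle[OF s0 x pq(1) sp \<open>u > 1\<close> pq(2)]) (auto intro: nearest)
  next
    case 2
    show ?thesis
      using s0 2 by (intro triangle[OF _ x E_sym[OF pq(1)] sq \<open>u > 1\<close> uq])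
        (auto intro: nearest simp: turn_uminus)
  qed
qed

text \<open>
  Seen from \<open>x\<close>, an edge crossing \<open>xy\<close> has an end on either side of \<open>xy\<close>. If \<open>y\<close> is extreme among the
  vertices other than \<open>c\<close>, one of these ends is \<open>c\<close>; this cannot happen at both extremes.
\<close>
lemma one_sided:
  assumes s: "s \<noteq> 0" and x: "x \<in> X"
    and all: "\<And>r. r \<in> R \<Longrightarrow> turn s b x r > 0"
    and gap: "\<And>y x'. \<lbrakk>y \<in> R - {c}; x' \<in> X; turn s b x x' > 0\<rbrakk> \<Longrightarrow> turn s b x' y \<le> 0"
  shows "\<exists>y\<in>R - {c}. unobstructed x y"
proof -
  have spoke: "closed_segment x y \<inter> closed_segment b x' = {}" if y: "y \<in> R - {c}" and x': "x' \<in> X - {x}" for y x'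
  proof (rule ccontr)
    assume "closed_segment x y \<inter> closed_segment b x' \<noteq> {}"
    then obtain m where "m \<in> closed_segment x y" "m \<in> closed_segment b x'"
      by auto
    then show False
      using spoke_crossing[of s x y x' m] s x all[of y] gap[of y x'] y x' by force
  qed
  \<comment> \<open>Seen from \<open>x\<close>, \<open>R\<close> lies on one side of the line
    \<open>b x\<close>, so \<open>D\<close> below orders it by angle.\<close>
  have view: "turn (- s) x b r > 0" if "r \<in> R" for r
    using all[OF that] by (simp add: turn_def algebra_simps)
  define D where "D = turn (- s) x"
  have straddle: "\<exists>v\<in>R. \<exists>w\<in>R. D y v < 0 \<and> D y w > 0" if y: "y \<in> R - {c}" and obs: "\<not> unobstructed x y" for y
  proof -
    obtain v w m where E: "(v, w) \<in> E" and nin: "y \<notin> {v, w}"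
      and m: "m \<in> closed_segment x y" "m \<in> closed_segment v w"
      using obs spoke[OF y] unfolding unobstructed_def by blast
    obtain k g where k: "m = (1 - k) *\<^sub>R x + k *\<^sub>R y"
      and g: "0 < g" "g < 1" "m = (1 - g) *\<^sub>R v + g *\<^sub>R w"
      using edge_crossing[OF s x _ E nin m] y by (metis DiffD1)
    have R: "v \<in> R" "w \<in> R" using E_sub[OF E] by auto
    have "D y m = 0"
      unfolding D_def k turn_convex_right by simp
    then have z: "(1 - g) * D y v + g * D y w = 0"
      using turn_convex_right[of "- s" x y g v w] g(3) by (simp add: D_def)
    have "D y v \<noteq> 0"
      unfolding D_def using s x y R nin disj by (intro gp_turn) auto
    then consider "D y v < 0" | "D y v > 0" by linarith
    then show ?thesis
    proof cases
      case 1
      then have "(1 - g) * D y v < 0" using g by (simp add: mult_less_0_iff)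
      then have "g * D y w > 0" using z by linarith
      then show ?thesis using 1 R g by (auto simp: zero_less_mult_iff)
    next
      case 2
      then have "(1 - g) * D y v > 0" using g by simp
      then have "g * D y w < 0" using z by linarith
      then show ?thesis using 2 R g by (auto simp: mult_less_0_iff)
    qed
  qed
  obtain y1 where y1: "y1 \<in> R - {c}" "\<And>r. r \<in> R - {c} \<Longrightarrow> D y1 r \<ge> 0"
    using turn_extreme[of "R - {c}" "- s" x b] fin R_big view unfolding D_def by (metis DiffD1 finite_Diff)
  \<comment> \<open>The reflection of \<open>b\<close> in \<open>x\<close> gives the opposite
    reference ray, from which the other extreme \<open>y2\<close> comes first.\<close>
  have view': "turn s x (2 *\<^sub>R x - b) r > 0" if "r \<in> R" for r
    using all[OF that] by (simp add: turn_def algebra_simps)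
  obtain y2 where y2: "y2 \<in> R - {c}" "\<And>r. r \<in> R - {c} \<Longrightarrow> turn s x y2 r \<ge> 0"
    using turn_extreme[of "R - {c}" s x "2 *\<^sub>R x - b"] fin R_big view' by (metis DiffD1 finite_Diff)
  have y2': "D y2 r \<le> 0" if "r \<in> R - {c}" for r
    using y2(2)[OF that] by (simp add: D_def turn_uminus)
  show ?thesis
  proof (rule ccontr)
    assume no: "\<not> ?thesis"
    obtain v where v: "v \<in> R" "D y1 v < 0" using straddle[OF y1(1)] no y1 by blast
    \<comment> \<open>The negative end at \<open>y1\<close> and the positive end at
      \<open>y2\<close> can only be \<open>c\<close>, which would precede the first vertex and
      follow the last.\<close>
    then have "D c y1 > 0"
      using y1(2)[of v] turn_swap[of "- s" x c y1] by (cases "v = c") (auto simp: D_def)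
    obtain w where w: "w \<in> R" "D y2 w > 0" using straddle[OF y2(1)] no y2 by blast
    then have "D y2 c > 0" using y2'[of w] by (cases "w = c") auto
    show False
      using turn_no_cycle[of "- s" x b y1 y2 c] view[of y1] view[of y2] view[OF c_in]
        y1 y2 \<open>D c y1 > 0\<close> \<open>D y2 c > 0\<close> by (auto simp: D_def)
  qed
qed

theorem ex_unobstructed: "\<exists>x\<in>X. \<exists>y\<in>R - {c}. unobstructed x y"
proof (rule ccontr)
  assume no: "\<not> ?thesis"
  have free: "b + t *\<^sub>R (x - b) \<notin> closed_segment v w" if "x \<in> X" "(v, w) \<in> E" "t > 1" for x v w t
    using ray_blocked[OF that] no by blast
  \<comment> \<open>By \<open>half_plane\<close> the first vertex of the half plane sees a leaf, so
    it must be \<open>c\<close>.\<close>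
  have c_side: "turn s b x c > 0" if s: "s \<noteq> 0" and x: "x \<in> X" and r: "r \<in> R" "turn s b x r > 0" for s x r
  proof -
    obtain y where y: "y \<in> {r \<in> R. turn s b x r > 0}"
      "\<And>r. r \<in> {r \<in> R. turn s b x r > 0} \<Longrightarrow> turn s b y r \<ge> 0"
      using turn_extreme[of "{r \<in> R. turn s b x r > 0}" s b x] fin r
      by (metis (mono_tags, lifting) empty_iff finite_Collect_conjI finite_subset mem_Collect_eq subsetI)
    have "\<exists>x\<in>X. unobstructed x y"
      using half_plane[OF s x free[OF x]] y by auto
    then have "y = c" using no y by auto
    then show ?thesis using y by simp
  qed
  \<comment> \<open>A vertex on the other side would, by \<open>c_side\<close>, put \<open>c\<close>
    there as well.\<close>
  have all: "turn s b x r > 0" if s: "s \<noteq> 0" and x: "x \<in> X" and c: "turn s b x c > 0" and r: "r \<in> R" for s x r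
  proof (rule ccontr)
    assume "\<not> turn s b x r > 0"
    moreover have "turn s b x r \<noteq> 0"
      using turn_b_nz[of s x r] s x r disj by auto
    ultimately have "turn (- s) b x r > 0" by (simp add: turn_uminus)
    then have "turn (- s) b x c > 0" using c_side[of "- s" x r] s x r by simp
    then show False using c by (simp add: turn_uminus)
  qed
  obtain x0 where x0: "x0 \<in> X" using X_ne by auto
  define s :: real where "s = sgn (turn 1 b x0 c)"
  have s: "s \<noteq> 0"
    using turn_b_nz[of 1 x0 c] x0 c_in disj by (auto simp: s_def sgn_zero_iff)
  have sc: "turn s b x0 c > 0"
    using s by (auto simp: s_def turn_def sgn_if split: if_splits)
  \<comment> \<open>\<open>x\<close> becomes the last leaf before \<open>c\<close>. A later leaf
    with a vertex of \<open>R\<close> beyond it would, by \<open>c_side\<close>, also precede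
    \<open>c\<close>.\<close>
  define X' where "X' = {x \<in> X. turn s b x c > 0}"
  have "finite X'" "X' \<noteq> {}" "\<And>x. x \<in> X' \<Longrightarrow> turn (- s) b c x > 0"
    using fin x0 sc by (auto simp: X'_def turn_uminus turn_swap[of s b _ c])
  then obtain x where x: "x \<in> X'" and last: "\<And>p. p \<in> X' \<Longrightarrow> turn (- s) b x p \<ge> 0"
    using turn_extreme[of X' "- s" b c] by metis
  have xX: "x \<in> X" "turn s b x c > 0" using x by (auto simp: X'_def)
  have "turn s b x' y \<le> 0" if y: "y \<in> R - {c}" and x': "x' \<in> X" "turn s b x x' > 0" for y x'
  proof (rule ccontr)
    assume "\<not> turn s b x' y \<le> 0"
    then have "turn s b x' c > 0" using c_side[OF s x'(1), of y] y by auto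
    then have "x' \<in> X'" using x' by (simp add: X'_def)
    then show False using last[of x'] x' by (simp add: turn_uminus)
  qed
  then show False
    using one_sided[OF s xX(1) all[OF s xX]] no xX by blast
qed

end

subsection \<open>Spanning trees\<close>

lemma adj_rel_iff [simp]: "(u, v) \<in> adj_rel E \<longleftrightarrow> {u, v} \<in> E"
  by (simp add: adj_rel_def)

lemma adj_rel_rtrancl_sym: "(u, v) \<in> (adj_rel E)\<^sup>* \<Longrightarrow> (v, u) \<in> (adj_rel E)\<^sup>*"
  using sym_rtrancl[of "adj_rel E"] by (auto simp: sym_def insert_commute)

lemma edge_nsetsD: "\<lbrakk>E \<subseteq> nsets P 2; {u, v} \<in> E\<rbrakk> \<Longrightarrow> u \<in> P \<and> v \<in> P \<and> u \<noteq> v"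
  by (auto simp: nsets_def card_2_iff doubleton_eq_iff)

lemma nsets_2E:
  assumes "e \<in> nsets P 2"
  obtains u v where "e = {u, v}" "u \<in> P" "v \<in> P" "u \<noteq> v"
  using assms by (auto simp: nsets_def card_2_iff)

lemma graph_connected_mono_rtrancl:
  assumes "graph_connected P E" "\<And>u v. {u, v} \<in> E \<Longrightarrow> (u, v) \<in> (adj_rel E')\<^sup>*"
  shows "graph_connected P E'"
proof -
  have "adj_rel E \<subseteq> (adj_rel E')\<^sup>*" using assms(2) by auto
  then have "(adj_rel E)\<^sup>* \<subseteq> (adj_rel E')\<^sup>*" by (rule rtrancl_subset_rtrancl)
  then show ?thesis using assms(1) by (auto simp: graph_connected_def)
qed

lemma graph_connected_exchange:
  assumes "graph_connected P E" "E - {{u, v}} \<subseteq> E'" "(u, v) \<in> (adj_rel E')\<^sup>*"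
  shows "graph_connected P E'"
proof (rule graph_connected_mono_rtrancl[OF assms(1)])
  fix a b assume "{a, b} \<in> E"
  show "(a, b) \<in> (adj_rel E')\<^sup>*"
  proof (cases "{a, b} = {u, v}")
    case True
    then show ?thesis
      using assms(3) adj_rel_rtrancl_sym[OF assms(3)] by (auto simp: doubleton_eq_iff)
  next
    case False
    then have "(a, b) \<in> adj_rel E'" using \<open>{a, b} \<in> E\<close> assms(2) by auto
    then show ?thesis by blast
  qed
qed

text \<open>A rooted tree as a parent function; the level \<open>d\<close> makes the iteration of
  \<open>p\<close> end at \<open>r\<close>, and \<open>p r\<close> is left arbitrary.\<close>

definition parent_map :: "'a set \<Rightarrow> 'a set set \<Rightarrow> 'a \<Rightarrow> ('a \<Rightarrow> 'a) \<Rightarrow> ('a \<Rightarrow> nat) \<Rightarrow> bool" where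
  "parent_map P E r p d \<longleftrightarrow> r \<in> P \<and> d r = 0 \<and>
     (\<forall>v\<in>P - {r}. p v \<in> P \<and> {v, p v} \<in> E \<and> d v = Suc (d (p v)))"

text \<open>Breadth-first search: \<open>d\<close> is the distance from \<open>r\<close>, and the
  parent is the penultimate vertex of a shortest walk from \<open>r\<close>.\<close>

lemma ex_parent_map:
  assumes E: "E \<subseteq> nsets P 2" and con: "graph_connected P E" and r: "r \<in> P"
  obtains p d where "parent_map P E r p d"
proof -
  define d where "d = graph_dist E r"
  have walk: "(r, v) \<in> adj_rel E ^^ d v" if "v \<in> P" for v
  proof -
    have "\<exists>k. (r, v) \<in> adj_rel E ^^ k"
      using con r that by (auto simp: graph_connected_def rtrancl_power)
    then show ?thesis unfolding d_def graph_dist_def by (rule LeastI_ex)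
  qed
  have least: "d v \<le> k" if "(r, v) \<in> adj_rel E ^^ k" for v k
    unfolding d_def graph_dist_def using that by (rule Least_le)
  have "\<exists>u. u \<in> P \<and> {v, u} \<in> E \<and> d v = Suc (d u)" if v: "v \<in> P - {r}" for v
  proof -
    have "d v \<noteq> 0"
      using walk[of v] v by (cases "d v") auto
    then obtain k where k: "d v = Suc k" by (cases "d v") auto
    then obtain u where u: "(r, u) \<in> adj_rel E ^^ k" "{u, v} \<in> E"
      using walk[of v] v by auto
    then have "u \<in> P" using edge_nsetsD[OF E] by blast
    moreover have "d u \<le> k" using least u by blast
    moreover have "d v \<le> Suc (d u)"
      using least[of v "Suc (d u)"] walk[OF \<open>u \<in> P\<close>] u by (auto simp: relcomp_unfold)
    ultimately show ?thesis using u k by (intro exI[of _ u]) (auto simp: insert_commute)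
  qed
  then obtain p where "\<forall>v\<in>P - {r}. p v \<in> P \<and> {v, p v} \<in> E \<and> d v = Suc (d (p v))"
    by metis
  moreover have "d r = 0" using least[of r 0] by simp
  ultimately show ?thesis using r that[of p d] by (auto simp: parent_map_def)
qed

text \<open>Two vertices with the same parent edge would be parents of each other, which the levels
  forbid.\<close>

lemma parent_map_inj:
  assumes "parent_map P E r p d"
  shows "inj_on (\<lambda>v. {v, p v}) (P - {r})"
proof (rule inj_onI)
  fix v w assume "v \<in> P - {r}" "w \<in> P - {r}" "{v, p v} = {w, p w}"
  then show "v = w"
    using assms unfolding parent_map_def doubleton_eq_iff by (metis n_not_Suc_n Suc_n_not_n less_Suc_eq lessI not_less_iff_gr_or_eq)
qed

lemma graph_connected_card:
  assumes "finite P" "E \<subseteq> nsets P 2" "graph_connected P E"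
  shows "card P - 1 \<le> card E"
proof -
  obtain r where r: "r \<in> P" using assms(3) by (auto simp: graph_connected_def)
  obtain p d where pm: "parent_map P E r p d"
    using ex_parent_map[OF assms(2,3) r] .
  have "finite E" using assms(1,2) finite_imp_finite_nsets finite_subset by blast
  moreover have "(\<lambda>v. {v, p v}) ` (P - {r}) \<subseteq> E"
    using pm by (auto simp: parent_map_def)
  ultimately have "card (P - {r}) \<le> card E"
    using card_inj_on_le[OF parent_map_inj[OF pm]] by blast
  then show ?thesis using r assms(1) by simp
qed

lemma rtrancl_simple_path:
  assumes "(u, v) \<in> (adj_rel F)\<^sup>*"
  shows "\<exists>vs. vs \<noteq> [] \<and> hd vs = u \<and> last vs = v \<and> distinct vs \<and> successively (\<lambda>a b. {a, b} \<in> F) vs"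
  using assms
proof (induction rule: rtrancl_induct)
  case base
  show ?case by (intro exI[of _ "[u]"]) simp
next
  case (step y z)
  then obtain vs where vs: "vs \<noteq> []" "hd vs = u" "last vs = y" "distinct vs"
    "successively (\<lambda>a b. {a, b} \<in> F) vs" by blast
  show ?case
  proof (cases "z \<in> set vs")
    \<comment> \<open>On a return to \<open>z\<close> the path is cut back to the earlier
      visit.\<close>
    case True
    then obtain xs ys where "vs = xs @ z # ys" by (auto simp: in_set_conv_decomp)
    then show ?thesis
      using vs by (intro exI[of _ "xs @ [z]"]) (auto simp: successively_append_iff hd_append split: if_splits)
  next
    case False
    then show ?thesis
      using vs step by (intro exI[of _ "vs @ [z]"]) (auto simp: successively_append_iff)
  qed
qed

text \<open>A further edge would close a cycle with a simple path of parent edges, extracted from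
  the walk between its ends through the root.\<close>

lemma spanning_tree_parent_map:
  assumes tree: "spanning_tree P E" and pm: "parent_map P E r p d"
  shows "E = (\<lambda>v. {v, p v}) ` (P - {r})"
proof (rule ccontr)
  define F where "F = (\<lambda>v. {v, p v}) ` (P - {r})"
  assume "E \<noteq> (\<lambda>v. {v, p v}) ` (P - {r})"
  moreover have "F \<subseteq> E" using pm by (auto simp: parent_map_def F_def)
  ultimately obtain g where g: "g \<in> E" "g \<notin> F" by (auto simp: F_def)
  have E: "E \<subseteq> nsets P 2" using tree by (simp add: spanning_tree_def)
  obtain u v where uv: "g = {u, v}" "u \<in> P" "v \<in> P" "u \<noteq> v"
    using g E by (blast elim: nsets_2E)
  have root: "(w, r) \<in> (adj_rel F)\<^sup>*" if "w \<in> P" for w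
    using that
  proof (induction "d w" arbitrary: w)
    case 0
    then show ?case using pm by (cases "w = r") (auto simp: parent_map_def)
  next
    case (Suc n)
    show ?case
    proof (cases "w = r")
      case False
      then have "{w, p w} \<in> F" "p w \<in> P" "d (p w) = n"
        using pm Suc.prems Suc.hyps(2) by (auto simp: parent_map_def F_def)
      then show ?thesis using Suc.hyps(1)[of "p w"] by (auto intro: converse_rtrancl_into_rtrancl)
    qed simp
  qed
  have path: "(u, v) \<in> (adj_rel F)\<^sup>*"
    using root[OF uv(2)] adj_rel_rtrancl_sym[OF root[OF uv(3)]] by (rule rtrancl_trans)
  obtain vs where vs: "vs \<noteq> []" "hd vs = u" "last vs = v" "distinct vs"
    "successively (\<lambda>a b. {a, b} \<in> F) vs"
    using rtrancl_simple_path[OF path] by blast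
  have uvF: "{u, v} \<notin> F" using uv(1) g(2) by simp
  obtain ws where ws: "vs = u # ws" using vs(1,2) by (cases vs) auto
  then have "ws \<noteq> []" using vs(3) uv(4) by auto
  then obtain w ws' where ws': "ws = w # ws'" by (cases ws) auto
  \<comment> \<open>\<open>is_cycle\<close> demands three vertices; a path with two would be the
    edge \<open>u v\<close> itself, which is not in \<open>F\<close>.\<close>
  have "ws' \<noteq> []"
  proof
    assume "ws' = []"
    then have "w = v" "{u, w} \<in> F" using vs(3,5) ws ws' by simp_all
    then show False using uvF by simp
  qed
  then have "length vs \<ge> 3" using ws ws' by (cases ws') simp_all
  moreover have "{vs ! i, vs ! (Suc i mod length vs)} \<in> E" if "i < length vs" for i
  proof (cases "Suc i < length vs")
    case True
    then show ?thesis
      using successively_nth[OF vs(5), of i] \<open>F \<subseteq> E\<close> by auto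
  next
    case False
    then have "length vs = Suc i" using that by simp
    then have i: "i = length vs - 1" "Suc i mod length vs = 0" by simp_all
    have "vs ! i = v" "vs ! (Suc i mod length vs) = u"
      unfolding i using vs(1-3) by (simp_all add: last_conv_nth hd_conv_nth)
    then show ?thesis using g uv by (simp add: insert_commute)
  qed
  ultimately have "is_cycle E vs" using vs by (simp add: is_cycle_def)
  then show False using tree by (auto simp: spanning_tree_def)
qed

text \<open>Trades the absence of cycles for a count, which is easy to check after an exchange. For
  the converse, deleting the closing edge of a cycle would leave a connected graph with too few
  edges.\<close>

lemma spanning_tree_iff_card:
  assumes P: "finite P"
  shows "spanning_tree P E \<longleftrightarrow> E \<subseteq> nsets P 2 \<and> graph_connected P E \<and> card E = card P - 1"
proof (intro iffI conjI; (elim conjE)?)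
  assume tree: "spanning_tree P E"
  then show E: "E \<subseteq> nsets P 2" and con: "graph_connected P E"
    by (simp_all add: spanning_tree_def)
  obtain r where r: "r \<in> P" using con by (auto simp: graph_connected_def)
  obtain p d where pm: "parent_map P E r p d"
    using ex_parent_map[OF E con r] .
  show "card E = card P - 1"
    using spanning_tree_parent_map[OF tree pm] card_image[OF parent_map_inj[OF pm]] r P by simp
next
  assume E: "E \<subseteq> nsets P 2" and con: "graph_connected P E" and card: "card E = card P - 1"
  have fin: "finite E" using P E finite_imp_finite_nsets finite_subset by blast
  have False if cyc: "is_cycle E vs" for vs
  proof -
    have vs: "length vs \<ge> 3" "distinct vs" "\<And>i. i < length vs \<Longrightarrow> {vs ! i, vs ! (Suc i mod length vs)} \<in> E"
      using cyc by (auto simp: is_cycle_def)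
    define n where "n = length vs - 1"
    have n: "length vs = Suc n" "n \<ge> 2" using vs(1) by (auto simp: n_def)
    define F where "F = E - {{vs ! 0, vs ! n}}"
    have "{vs ! i, vs ! Suc i} \<in> F" if "i < n" for i
    proof -
      have "{vs ! i, vs ! Suc i} \<in> E" using vs(3)[of i] that n by simp
      moreover have "{vs ! i, vs ! Suc i} \<noteq> {vs ! 0, vs ! n}"
        using vs(2) n that by (auto simp: doubleton_eq_iff nth_eq_iff_index_eq)
      ultimately show ?thesis by (simp add: F_def)
    qed
    then have "(vs ! 0, vs ! i) \<in> (adj_rel F)\<^sup>*" if "i \<le> n" for i
      using that by (induction i) (auto intro: rtrancl_into_rtrancl)
    then have "(vs ! 0, vs ! n) \<in> (adj_rel F)\<^sup>*" by simp
    then have "graph_connected P F"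
      using graph_connected_exchange[OF con, of "vs ! 0" "vs ! n" F] by (simp add: F_def)
    then have "card P - 1 \<le> card F"
      using graph_connected_card[OF P, of F] E by (auto simp: F_def)
    moreover have "{vs ! 0, vs ! n} \<in> E" using vs(3)[of n] n by (simp add: insert_commute)
    then have "card F < card E" using fin unfolding F_def by (intro psubset_card_mono) auto
    ultimately show False using card by simp
  qed
  then show "spanning_tree P E" using E con by (auto simp: spanning_tree_def)
qed

lemma spanning_tree_exchange:
  assumes "finite P" "spanning_tree P E" "{u, v} \<in> E" "f \<in> nsets P 2" "f \<notin> E"
    and "(u, v) \<in> (adj_rel (insert f E - {{u, v}}))\<^sup>*"
  shows "spanning_tree P (insert f E - {{u, v}})"
proof -
  have E: "E \<subseteq> nsets P 2" "graph_connected P E" "card E = card P - 1"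
    using assms(1,2) spanning_tree_iff_card by auto
  have "finite E" using assms(1) E finite_imp_finite_nsets finite_subset by blast
  then have "card (insert f E - {{u, v}}) = card P - 1"
    using assms(3,5) E(3) by simp
  moreover have "graph_connected P (insert f E - {{u, v}})"
    using graph_connected_exchange[OF E(2) _ assms(6)] by auto
  ultimately show ?thesis
    using E assms(1,4) spanning_tree_iff_card[OF assms(1)] by auto
qed

text \<open>For an arbitrary root, \<open>x\<close> is a deepest vertex and \<open>b\<close> its
  parent, so all children of \<open>b\<close> are leaves. The star arises in two ways:
  \<open>b\<close> is the root, or \<open>b\<close> is the only neighbour of the root.\<close>

lemma spanning_tree_cases:
  assumes P: "finite P" "card P \<ge> 3" and tree: "spanning_tree P T"
  obtains (center) b where "b \<in> P" "T = (\<lambda>v. {b, v}) ` (P - {b})"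
  | (broom) b c x y where "{b, c} \<in> T" "{b, x} \<in> T" "{c, y} \<in> T" "distinct [b, c, x, y]"
      "\<And>u w. \<lbrakk>{b, u} \<in> T; u \<noteq> c; {u, w} \<in> T\<rbrakk> \<Longrightarrow> w = b"
proof -
  have T: "T \<subseteq> nsets P 2" "graph_connected P T"
    using tree by (simp_all add: spanning_tree_def)
  obtain r where r: "r \<in> P" using T by (auto simp: graph_connected_def)
  obtain p d where pm: "parent_map P T r p d"
    using ex_parent_map[OF T r] .
  have Teq: "T = (\<lambda>v. {v, p v}) ` (P - {r})"
    using spanning_tree_parent_map[OF tree pm] .
  have par: "p v \<in> P" "{v, p v} \<in> T" "d v = Suc (d (p v))" if "v \<in> P" "v \<noteq> r" for v
    using pm that by (auto simp: parent_map_def)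
  have d0: "d r = 0" using pm by (simp add: parent_map_def)
  have edgeD: "(u = p v \<and> v \<in> P - {r}) \<or> (v = p u \<and> u \<in> P - {r})" if "{u, v} \<in> T" for u v
    using that unfolding Teq by (auto simp: doubleton_eq_iff)
  have "Max (d ` P) \<in> d ` P" using P r by (intro Max_in) auto
  then obtain x where x: "x \<in> P" "d x = Max (d ` P)" by auto
  have dx: "d v \<le> d x" if "v \<in> P" for v
    using x P that by simp
  have "P \<noteq> {r}" using P by auto
  then obtain v where "v \<in> P" "v \<noteq> r" using r by auto
  then have xr: "x \<noteq> r" using dx[of v] par(3)[of v] d0 by auto
  define b where "b = p x"
  have b: "b \<in> P" "{b, x} \<in> T" "d x = Suc (d b)"
    using par[OF x(1) xr] by (auto simp: b_def insert_commute)
  show ?thesis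
  proof (cases "b = r")
    case True
    have "p v = r" if "v \<in> P" "v \<noteq> r" for v
      using par[OF that] dx[OF that(1)] b d0 True par(3)[of "p v"] by (cases "p v = r") auto
    then have "T = (\<lambda>v. {b, v}) ` (P - {b})"
      unfolding Teq True by (auto simp: insert_commute)
    then show ?thesis using center b by blast
  next
    case False
    define c where "c = p b"
    have c: "c \<in> P" "{b, c} \<in> T" "d b = Suc (d c)"
      using par[OF b(1) False] by (auto simp: c_def)
    have leaf: "w = b" if "{b, u} \<in> T" "u \<noteq> c" "{u, w} \<in> T" for u w
    proof -
      have u: "b = p u" "u \<in> P - {r}" using edgeD[OF that(1)] that(2) c_def by auto
      show ?thesis
        using edgeD[OF that(3)]
      proof
        assume w: "u = p w \<and> w \<in> P - {r}"
        then show ?thesis using par(3)[of w] par(3)[of u] u dx[of w] b by auto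
      qed (use u in auto)
    qed
    have xc: "x \<noteq> c" "b \<noteq> c" "x \<noteq> b" using b c by auto
    show ?thesis
    proof (cases "\<exists>y. {c, y} \<in> T \<and> y \<noteq> b")
      case True
      then obtain y where y: "{c, y} \<in> T" "y \<noteq> b" by blast
      then have "y \<noteq> c" using edge_nsetsD[OF T(1)] by blast
      moreover have "y \<noteq> x" using leaf[of x c] b y xc by (auto simp: insert_commute)
      ultimately show ?thesis using broom[OF c(2) b(2) y(1)] xc y leaf by auto
    next
      case no: False
      \<comment> \<open>Otherwise the parent of \<open>c\<close> would be a neighbour of
        \<open>c\<close> other than \<open>b\<close>. Hence \<open>x\<close> and the deepest level
        are at distance 2 from the root.\<close>
      have cr: "c = r"
        using no par[of c] c by (metis n_not_Suc_n not_less_eq Suc_n_not_le_n lessI less_SucI less_not_refl)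
      have one: "v = b" if "v \<in> P" "v \<noteq> r" "p v = r" for v
        using par(2)[OF that(1,2)] that no cr by (auto simp: insert_commute)
      have two: "p v = b" if v: "v \<in> P" "v \<noteq> r" "v \<noteq> b" for v
      proof -
        have pr: "p v \<noteq> r" using one v by auto
        have "d (p (p v)) = 0"
          using dx[OF v(1)] par(3)[OF v(1,2)] par(3)[OF par(1)[OF v(1,2)] pr] b c cr d0 by simp
        then have "p (p v) = r" using par(3)[of "p (p v)"] par(1)[OF par(1)[OF v(1,2)] pr] by fastforce
        then show ?thesis using one[of "p v"] par(1)[OF v(1,2)] pr by simp
      qed
      have "T = (\<lambda>v. {b, v}) ` (P - {b})"
      proof (rule set_eqI)
        fix e
        have "e \<in> T \<longleftrightarrow> (\<exists>v\<in>P - {r}. e = {v, p v})" unfolding Teq by auto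
        also have "\<dots> \<longleftrightarrow> e = {b, r} \<or> (\<exists>v\<in>P - {r, b}. e = {v, b})"
          using two b(1) False c_def cr by (metis DiffE DiffI insertCI insertE singletonD)
        also have "\<dots> \<longleftrightarrow> e \<in> (\<lambda>v. {b, v}) ` (P - {b})"
          using r False by (auto simp: insert_commute)
        finally show "e \<in> T \<longleftrightarrow> e \<in> (\<lambda>v. {b, v}) ` (P - {b})" .
      qed
      then show ?thesis using center b by blast
    qed
  qed
qed

text \<open>Routes through \<open>b\<close> have at most two edges, and since \<open>card P\<close>
  is at least 3 there are two vertices besides \<open>b\<close>, which are not adjacent.\<close>

lemma center_imp_is_star:
  assumes P: "finite P" "card P \<ge> 3" and tree: "spanning_tree P T"
    and b: "b \<in> P" and T: "T = (\<lambda>v. {b, v}) ` (P - {b})"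
  shows "is_star P T"
proof -
  let ?D = "{graph_dist T u v |u v. u \<in> P \<and> v \<in> P}"
  have fin: "finite ?D"
    using P(1) by (intro finite_image_set2) simp_all
  have le: "graph_dist T u v \<le> 2" if "u \<in> P" "v \<in> P" for u v
  proof -
    have "\<exists>k\<le>2. (u, v) \<in> adj_rel T ^^ k"
    proof (cases "u = v \<or> u = b \<or> v = b")
      case True
      then show ?thesis
        using that unfolding T
        by (cases "u = v") (auto intro: exI[of _ 0] exI[of _ 1] simp: insert_commute)
    next
      case False
      then have "(u, b) \<in> adj_rel T" "(b, v) \<in> adj_rel T"
        using that unfolding T by (auto simp: insert_commute)
      then show ?thesis by (intro exI[of _ 2]) (auto simp: numeral_2_eq_2)
    qed
    then show ?thesis
      unfolding graph_dist_def by (meson Least_le order_trans)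
  qed
  have "\<exists>u\<in>P. \<exists>v\<in>P. graph_dist T u v = 2"
  proof -
    have "card (P - {b}) \<ge> 2" using P b by simp
    then obtain u v where uv: "u \<in> P - {b}" "v \<in> P - {b}" "u \<noteq> v"
      by (meson card_2_iff' ex_card subset_iff)
    have "(u, v) \<in> adj_rel T ^^ 2"
      using uv unfolding T by (auto simp: numeral_2_eq_2 relcomp_unfold insert_commute)
    moreover have "2 \<le> k" if "(u, v) \<in> adj_rel T ^^ k" for k
    proof (rule ccontr)
      assume "\<not> 2 \<le> k"
      then have "k = 0 \<or> k = 1" by auto
      then show False using that uv unfolding T by (auto simp: doubleton_eq_iff)
    qed
    ultimately have "graph_dist T u v = 2"
      unfolding graph_dist_def by (rule Least_equality)
    then show ?thesis using uv by blast
  qed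
  then have "2 \<in> ?D" by force
  then have "graph_diameter P T = 2"
    unfolding graph_diameter_def using fin le by (intro Max_eqI) auto
  then show ?thesis using tree by (simp add: is_star_def)
qed

text \<open>The only neighbour of \<open>x\<close> is \<open>b\<close>, which is not adjacent to
  \<open>y\<close>; so \<open>x\<close> and \<open>y\<close> are at distance at least 3.\<close>

lemma broom_not_is_star:
  assumes P: "finite P" and T: "T \<subseteq> nsets P 2"
    and edges: "{b, c} \<in> T" "{b, x} \<in> T" "{c, y} \<in> T" "distinct [b, c, x, y]"
    and leaf: "\<And>u w. \<lbrakk>{b, u} \<in> T; u \<noteq> c; {u, w} \<in> T\<rbrakk> \<Longrightarrow> w = b"
  shows "\<not> is_star P T"
proof
  assume star: "is_star P T"
  then have "graph_connected P T" by (simp add: is_star_def spanning_tree_def)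
  have xy: "x \<in> P" "y \<in> P" using edges edge_nsetsD[OF T] by blast+
  have "finite {graph_dist T u v |u v. u \<in> P \<and> v \<in> P}"
    using P by (intro finite_image_set2) simp_all
  then have "graph_dist T x y \<le> graph_diameter P T"
    unfolding graph_diameter_def using xy by (intro Max_ge) auto
  then have le: "graph_dist T x y \<le> 2" using star by (simp add: is_star_def)
  have "\<exists>k. (x, y) \<in> adj_rel T ^^ k"
    using \<open>graph_connected P T\<close> xy by (auto simp: graph_connected_def rtrancl_power)
  then have walk: "(x, y) \<in> adj_rel T ^^ graph_dist T x y"
    unfolding graph_dist_def by (rule LeastI_ex)
  have xb: "w = b" if "{x, w} \<in> T" for w
    using leaf[of x w] edges that by auto
  have "{b, y} \<notin> T"
    using leaf[of y c] edges by (auto simp: insert_commute)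
  moreover have "graph_dist T x y = 0 \<or> graph_dist T x y = 1 \<or> graph_dist T x y = 2"
    using le by auto
  ultimately show False
    using walk edges(4) xb by (auto simp: numeral_2_eq_2)
qed

subsection \<open>U-cliques\<close>

lemma crosses_sym: "crosses e f \<Longrightarrow> crosses f e"
  unfolding crosses_def by (metis Int_commute distinct_length_2_or_more distinct_singleton)

lemma crosses_disjoint: "crosses e f \<Longrightarrow> e \<inter> f = {}"
  unfolding crosses_def by auto

lemma crosses_iff:
  assumes "distinct [a, b, c, d]"
  shows "crosses {a, b} {c, d} \<longleftrightarrow> closed_segment a b \<inter> closed_segment c d \<noteq> {}"
proof
  assume "crosses {a, b} {c, d}"
  then obtain a' b' c' d' where *: "{a, b} = {a', b'}" "{c, d} = {c', d'}"
    "closed_segment a' b' \<inter> closed_segment c' d' \<noteq> {}"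
    unfolding crosses_def by blast
  have "closed_segment a b = closed_segment a' b'"
    using *(1) by (metis doubleton_eq_iff closed_segment_commute)
  moreover have "closed_segment c d = closed_segment c' d'"
    using *(2) by (metis doubleton_eq_iff closed_segment_commute)
  ultimately show "closed_segment a b \<inter> closed_segment c d \<noteq> {}" using *(3) by metis
qed (use assms in \<open>unfold crosses_def, blast\<close>)

lemma SSTs_iff: "E \<in> SSTs P \<longleftrightarrow> spanning_tree P E \<and> (\<forall>e\<in>E. \<forall>f\<in>E. \<not> crosses e f)"
  by (simp add: SSTs_def)

lemma no_crosses_insert:
  assumes "\<forall>e\<in>E. \<forall>f\<in>E. \<not> crosses e f" "f \<in> nsets P 2" "\<And>e. e \<in> E \<Longrightarrow> \<not> crosses f e"
  shows "\<forall>e\<in>insert f E. \<forall>g\<in>insert f E. \<not> crosses e g"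
proof -
  have "\<not> crosses f f"
    using crosses_disjoint[of f f] assms(2) by (auto elim: nsets_2E)
  then show ?thesis using assms crosses_sym by blast
qed

lemma finite_spanning_tree: "finite P \<Longrightarrow> spanning_tree P T \<Longrightarrow> finite T"
  using finite_imp_finite_nsets finite_subset by (auto simp: spanning_tree_def)

text \<open>Spanning trees have equally many edges, so exactly one edge is omitted;
  \<open>g = f\<close> gives \<open>T\<close> itself.\<close>

lemma spanning_tree_subset_insert:
  assumes P: "finite P" and trees: "spanning_tree P T" "spanning_tree P C"
    and C: "C \<subseteq> insert f T" and f: "f \<notin> T"
  obtains g where "g \<in> insert f T" "C = insert f T - {g}"
proof -
  have fin: "finite T" "finite C" using P trees finite_spanning_tree by auto
  have "card C = card T" using trees spanning_tree_iff_card[OF P] by auto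
  then have "card (insert f T - C) = 1"
    using fin f C by (simp add: card_Diff_subset)
  then obtain g where "insert f T - C = {g}" by (auto simp: card_1_singleton_iff)
  then show ?thesis using that[of g] C by auto
qed

text \<open>All trees have the same size, so \<open>A\<close> and \<open>B\<close> differ by one
  edge each and their union has one edge more than \<open>T\<close>.\<close>

lemma G_adjacent_U_clique_union:
  assumes P: "finite P" and adj: "G_adjacent P A B" and T: "T \<in> U_clique P A B"
  obtains f where "f \<in> nsets P 2" "f \<notin> T" "A \<union> B = insert f T"
proof -
  have trees: "spanning_tree P A" "spanning_tree P B" "spanning_tree P T"
    using adj T by (auto simp: G_adjacent_def U_clique_def SSTs_iff)
  then have fin: "finite A" "finite B" "finite T" using P finite_spanning_tree by auto
  have card: "card A = card T" "card B = card T"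
    using trees spanning_tree_iff_card[OF P] by auto
  have "card (A - B) + card (B - A) = 2"
    using adj fin card_Un_disjoint[of "A - B" "B - A"] by (auto simp: G_adjacent_def)
  moreover have "card (A - B) + card (A \<inter> B) = card A" "card (B - A) + card (A \<inter> B) = card B"
    using fin by (metis card_Diff_subset_Int card_mono finite_Int Int_lower1 le_add_diff_inverse2,
        metis card_Diff_subset_Int card_mono finite_Int Int_lower1 le_add_diff_inverse2 Int_commute)
  ultimately have "card (B - A) = 1" using card by linarith
  then have "card (A \<union> B) = card T + 1"
    using fin card by (metis Un_Diff_cancel card_Un_disjoint Diff_disjoint finite_Diff)
  moreover have TAB: "T \<subseteq> A \<union> B" using T by (simp add: U_clique_def)
  ultimately have "card (A \<union> B - T) = 1"
    using fin by (simp add: card_Diff_subset)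
  then obtain f where f: "A \<union> B - T = {f}" by (auto simp: card_1_singleton_iff)
  moreover have "A \<subseteq> nsets P 2" "B \<subseteq> nsets P 2"
    using trees by (auto simp: spanning_tree_def)
  ultimately show ?thesis using that[of f] TAB by auto
qed

text \<open>For \<open>f = {u, v}\<close> the cycle is the triangle \<open>b u v\<close>; the
  members of the U-clique arise by omitting one of its three edges.\<close>

lemma star_U_clique_card:
  assumes P: "finite P" and adj: "G_adjacent P A B" and TU: "T \<in> U_clique P A B"
    and b: "b \<in> P" and T: "T = (\<lambda>v. {b, v}) ` (P - {b})"
  shows "card (U_clique P A B) = 3"
proof -
  obtain f where f: "f \<in> nsets P 2" "f \<notin> T" and AB: "A \<union> B = insert f T"
    using G_adjacent_U_clique_union[OF P adj TU] .
  have TS: "T \<in> SSTs P" and trees: "spanning_tree P T"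
    using TU by (auto simp: U_clique_def SSTs_iff)
  obtain u v where uv: "f = {u, v}" "u \<in> P" "v \<in> P" "u \<noteq> v"
    using f(1) by (rule nsets_2E)
  have ub: "u \<noteq> b" "v \<noteq> b"
    using f(2) uv unfolding T by (auto simp: insert_commute)
  have buv: "{b, u} \<in> T" "{b, v} \<in> T"
    using uv ub unfolding T by auto
  have fb: "f \<noteq> {b, u}" "f \<noteq> {b, v}" "{b, u} \<noteq> {b, v}"
    using f(2) buv uv(4) by (auto simp: doubleton_eq_iff)
  define F where "F = insert f T"
  have only: "C \<in> {T, F - {{b, u}}, F - {{b, v}}}" if tC: "spanning_tree P C" and CF: "C \<subseteq> F" for C
  proof -
    obtain g where g: "g \<in> F" "C = F - {g}"
      using spanning_tree_subset_insert[OF P trees tC _ f(2)] CF by (auto simp: F_def)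
    show ?thesis
    proof (cases "g = f")
      case True
      then show ?thesis using g f(2) by (simp add: F_def)
    next
      case False
      then obtain w where w: "g = {b, w}" "w \<in> P" "w \<noteq> b" using g by (auto simp: F_def T)
      \<comment> \<open>\<open>w\<close> has a neighbour in \<open>C\<close>, but its only edge in
        \<open>T\<close> is gone, so \<open>f\<close> must supply one.\<close>
      have "(w, b) \<in> (adj_rel C)\<^sup>*"
        using tC w b by (simp add: spanning_tree_def graph_connected_def)
      then obtain z where "{w, z} \<in> C"
        using w(3) by (cases rule: converse_rtranclE) auto
      then have "w = u \<or> w = v"
        using g w uv unfolding F_def T by (auto simp: doubleton_eq_iff)
      then show ?thesis using g w by auto
    qed
  qed
  have AT: "spanning_tree P A" "spanning_tree P B" "A \<noteq> B"
    using adj by (auto simp: G_adjacent_def SSTs_iff)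
  have clean: "\<not> crosses f e" if e: "e \<in> T" for e
  proof (cases "e \<in> {{b, u}, {b, v}}")
    case True
    then show ?thesis using crosses_disjoint[of f e] uv by auto
  next
    case False
    \<comment> \<open>One of \<open>A\<close> and \<open>B\<close> contains \<open>f\<close> and all
      of \<open>T\<close> except \<open>b u\<close> or \<open>b v\<close>; as it is free of
      crossings, \<open>f\<close> crosses none of these edges.\<close>
    obtain D where D: "D \<in> {A, B}" "D \<noteq> T" using AT(3) by blast
    then have "D \<in> SSTs P" using adj by (auto simp: G_adjacent_def)
    moreover have "spanning_tree P D" "D \<subseteq> F"
      using D(1) AT(1,2) AB unfolding F_def by blast+
    then have "D = F - {{b, u}} \<or> D = F - {{b, v}}"
      using only[of D] D(2) by blast
    then have "e \<in> D \<and> f \<in> D"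
      using e False fb by (elim disjE) (simp_all add: F_def)
    ultimately show ?thesis by (auto simp: SSTs_iff)
  qed
  have "\<forall>e\<in>F. \<forall>g\<in>F. \<not> crosses e g"
    unfolding F_def using no_crosses_insert[OF _ f(1) clean] TS by (auto simp: SSTs_iff)
  moreover have "(b, u) \<in> (adj_rel (F - {{b, u}}))\<^sup>*"
  proof (rule converse_rtrancl_into_rtrancl[of _ v])
    show "(b, v) \<in> adj_rel (F - {{b, u}})"
      using buv fb by (simp add: F_def)
    show "(v, u) \<in> (adj_rel (F - {{b, u}}))\<^sup>*"
      using fb uv(1) by (intro r_into_rtrancl) (simp add: F_def insert_commute)
  qed
  then have "spanning_tree P (F - {{b, u}})"
    unfolding F_def using spanning_tree_exchange[OF P trees buv(1) f] by blast
  moreover have "(b, v) \<in> (adj_rel (F - {{b, v}}))\<^sup>*"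
  proof (rule converse_rtrancl_into_rtrancl[of _ u])
    show "(b, u) \<in> adj_rel (F - {{b, v}})"
      using buv fb by (simp add: F_def)
    show "(u, v) \<in> (adj_rel (F - {{b, v}}))\<^sup>*"
      using fb uv(1) by (intro r_into_rtrancl) (simp add: F_def insert_commute)
  qed
  then have "spanning_tree P (F - {{b, v}})"
    unfolding F_def using spanning_tree_exchange[OF P trees buv(2) f] by blast
  ultimately have "{T, F - {{b, u}}, F - {{b, v}}} \<subseteq> U_clique P A B"
    using TS by (auto simp: U_clique_def SSTs_iff AB F_def)
  moreover have "U_clique P A B \<subseteq> {T, F - {{b, u}}, F - {{b, v}}}"
    using only by (auto simp: U_clique_def SSTs_iff AB F_def)
  ultimately have "U_clique P A B = {T, F - {{b, u}}, F - {{b, v}}}" by blast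
  moreover have "distinct [T, F - {{b, u}}, F - {{b, v}}]"
  proof -
    have "f \<in> F - {{b, u}}" "f \<in> F - {{b, v}}" "{b, u} \<in> F - {{b, v}}"
      using fb buv by (simp_all add: F_def)
    then show ?thesis using f(2) by auto
  qed
  ultimately show ?thesis by simp
qed

text \<open>The walk is cut at its last visit to \<open>a\<close>; \<open>y\<close> is the vertex
  that follows.\<close>

lemma rtrancl_last_visit:
  assumes "(a, z) \<in> S\<^sup>*" "z \<noteq> a"
  shows "\<exists>y. (a, y) \<in> S \<and> y \<noteq> a \<and> (y, z) \<in> (S \<inter> {(u, v). u \<noteq> a \<and> v \<noteq> a})\<^sup>*"
  using assms
proof (induction rule: rtrancl_induct)
  case (step y z)
  show ?case
  proof (cases "y = a")
    case True
    then show ?thesis using step by blast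
  next
    case False
    then obtain w where w: "(a, w) \<in> S" "w \<noteq> a" "(w, y) \<in> (S \<inter> {(u, v). u \<noteq> a \<and> v \<noteq> a})\<^sup>*"
      using step.IH by blast
    moreover have "(y, z) \<in> S \<inter> {(u, v). u \<noteq> a \<and> v \<noteq> a}" using False step by auto
    ultimately show ?thesis by (meson rtrancl.rtrancl_into_rtrancl)
  qed
qed simp

text \<open>The cycle closed by \<open>f = {x, y}\<close> runs from \<open>b\<close> through
  \<open>x\<close> and \<open>y\<close>, then inside the tree to a neighbour \<open>y'\<close> of
  \<open>c\<close>, and back through \<open>c\<close>. Omitting \<open>f\<close>,
  \<open>b c\<close>, \<open>b x\<close> or \<open>c y'\<close> gives four trees.\<close>

lemma broom_bad_U_clique:
  assumes P: "finite P" "general_position P" and TS: "T \<in> SSTs P"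
    and bc: "{b, c} \<in> T" and bx0: "{b, x0} \<in> T" and cy0: "{c, y0} \<in> T"
    and dist: "distinct [b, c, x0, y0]"
    and leaf: "\<And>u w. \<lbrakk>{b, u} \<in> T; u \<noteq> c; {u, w} \<in> T\<rbrakk> \<Longrightarrow> w = b"
  shows "\<exists>B. G_adjacent P T B \<and> card (U_clique P T B) \<noteq> 3"
proof -
  have tree: "spanning_tree P T" and clean: "\<And>e f. \<lbrakk>e \<in> T; f \<in> T\<rbrakk> \<Longrightarrow> \<not> crosses e f"
    using TS by (auto simp: SSTs_iff)
  have T: "T \<subseteq> nsets P 2" and con: "graph_connected P T"
    using tree by (auto simp: spanning_tree_def)
  note edge = edge_nsetsD[OF T]
  define X where "X = {u. {b, u} \<in> T \<and> u \<noteq> c}"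
  define R where "R = P - {b} - X"
  \<comment> \<open>These edges stay within \<open>R\<close>, because every member of
    \<open>X\<close> is a leaf at \<open>b\<close>.\<close>
  define E where "E = {(v, w). {v, w} \<in> T \<and> v \<noteq> b \<and> w \<noteq> b}"
  have X: "X \<subseteq> P" "b \<notin> X" "x0 \<in> X"
    using edge edge[of b b] bx0 dist by (auto simp: X_def)
  have bP: "b \<in> P" using edge[OF bc] by simp
  have cR: "c \<in> R" using edge[OF bc] by (auto simp: R_def X_def)
  have y0X: "y0 \<notin> X" using leaf[of y0 c] cy0 dist by (auto simp: X_def insert_commute)
  then have y0R: "y0 \<in> R" using edge[OF cy0] dist by (auto simp: R_def)
  have ER: "v \<in> R \<and> w \<in> R \<and> v \<noteq> w" if "(v, w) \<in> E" for v w
  proof -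
    have e: "{v, w} \<in> T" "v \<noteq> b" "w \<noteq> b" using that by (auto simp: E_def)
    then have "v \<notin> X" "w \<notin> X"
      using leaf[of v w] leaf[of w v] by (auto simp: X_def insert_commute)
    then show ?thesis using e edge[OF e(1)] by (auto simp: R_def)
  qed
  interpret fan b c X R E
  proof
    show "finite X" "finite R" using P X finite_subset by (auto simp: R_def)
    show "v \<in> R \<and> w \<in> R \<and> v \<noteq> w" if "(v, w) \<in> E" for v w using ER[OF that] .
    show "(w, v) \<in> E" if "(v, w) \<in> E" for v w using that by (auto simp: E_def insert_commute)
    show "turn 1 u v w \<noteq> 0" if "u \<in> insert b (X \<union> R)" "v \<in> insert b (X \<union> R)" "w \<in> insert b (X \<union> R)"
      "distinct [u, v, w]" for u v w
    proof -
      have "u \<in> P" "v \<in> P" "w \<in> P" using that X bP by (auto simp: R_def)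
      then show ?thesis
        using P(2) that(4) turn_eq_0_imp_collinear unfolding general_position_def by blast
    qed
    show "b \<notin> X" "b \<notin> R" "X \<inter> R = {}" using X by (auto simp: R_def)
    show "c \<in> R" using cR .
    show "R - {c} \<noteq> {}" using y0R dist by auto
    show "X \<noteq> {}" using X by auto
    show "closed_segment v w \<inter> closed_segment b x = {}" if "(v, w) \<in> E" "x \<in> X" for v w x
    proof -
      have "distinct [v, w, b, x]" using that ER[OF that(1)] X by (auto simp: R_def)
      then show ?thesis
        using crosses_iff[of v w b x] clean[of "{v, w}" "{b, x}"] that by (auto simp: E_def X_def)
    qed
    show "closed_segment v w \<inter> closed_segment p q = {}"
      if "(v, w) \<in> E" "(p, q) \<in> E" "{v, w} \<inter> {p, q} = {}" for v w p q
    proof -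
      have "distinct [v, w, p, q]" using that ER[OF that(1)] ER[OF that(2)] by auto
      then show ?thesis
        using crosses_iff[of v w p q] clean[of "{v, w}" "{p, q}"] that by (auto simp: E_def)
    qed
  qed
  obtain x y where x: "x \<in> X" and y: "y \<in> R" "y \<noteq> c" and unob: "unobstructed x y"
    using ex_unobstructed by blast
  have bx: "{b, x} \<in> T" "x \<noteq> c" using x by (auto simp: X_def)
  have yX: "y \<noteq> b" "y \<notin> X" "y \<in> P" using y by (auto simp: R_def)
  have xy: "x \<noteq> y" "x \<noteq> b" "x \<in> P" "b \<noteq> c" using x yX X edge[OF bc] by auto
  define f where "f = {x, y}"
  have f: "f \<in> nsets P 2" using xy yX by (auto simp: f_def nsets_def)
  have fT: "f \<notin> T" using leaf[OF bx, of y] yX by (auto simp: f_def)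
  \<comment> \<open>An edge at \<open>b\<close> other than \<open>b c\<close> is a spoke, so
    \<open>unobstructed\<close> covers all remaining edges disjoint from \<open>f\<close>.\<close>
  have f_cross: "e = {b, c}" if e: "e \<in> T" "crosses f e" for e
  proof (rule ccontr)
    assume ne: "e \<noteq> {b, c}"
    obtain v w where vw: "e = {v, w}" "v \<noteq> w" "v \<in> P" "w \<in> P"
      using e(1) T by (blast elim: nsets_2E)
    have dj: "f \<inter> e = {}" using crosses_disjoint[OF e(2)] .
    then have d: "distinct [x, y, v, w]" using vw xy by (auto simp: f_def)
    have seg: "closed_segment x y \<inter> closed_segment v w \<noteq> {}"
      using crosses_iff[OF d] e vw by (simp add: f_def)
    consider "v = b" | "w = b" | "v \<noteq> b" "w \<noteq> b" by blast
    then show False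
    proof cases
      case 1
      then have "w \<in> X - {x}" using vw e ne d by (auto simp: X_def)
      then show False using unob seg 1 by (auto simp: unobstructed_def)
    next
      case 2
      then have "v \<in> X - {x}" using vw e ne d by (auto simp: X_def insert_commute)
      then show False using unob seg 2 closed_segment_commute[of v b] by (auto simp: unobstructed_def)
    next
      case 3
      then have "(v, w) \<in> E" using vw e by (auto simp: E_def)
      then show False using unob seg d by (force simp: unobstructed_def)
    qed
  qed
  \<comment> \<open>Carries the part of the cycle between \<open>y'\<close> and \<open>y\<close>,
    which survives the removal of \<open>b c\<close>, \<open>b x\<close> or \<open>c y'\<close>.
    Possibly \<open>y' = y\<close>.\<close>
  define Q where "Q = {e \<in> T. b \<notin> e \<and> c \<notin> e}"
  obtain y' where y': "{c, y'} \<in> T" "y' \<noteq> c"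
    "(y', y) \<in> (adj_rel T \<inter> {(u, v). u \<noteq> c \<and> v \<noteq> c})\<^sup>*"
  proof -
    have "(c, y) \<in> (adj_rel T)\<^sup>*"
      using con cR y by (auto simp: graph_connected_def R_def)
    then show ?thesis using rtrancl_last_visit[of c y "adj_rel T"] y that by auto
  qed
  \<comment> \<open>Walks from \<open>b\<close> that avoid \<open>c\<close> reach only
    \<open>b\<close> and its leaves.\<close>
  have y'b: "y' \<noteq> b"
  proof
    assume "y' = b"
    have "z \<in> insert b X" if "(y', z) \<in> (adj_rel T \<inter> {(u, v). u \<noteq> c \<and> v \<noteq> c})\<^sup>*" for z
      using that
    proof (induction rule: rtrancl_induct)
      case base
      show ?case using \<open>y' = b\<close> by simp
    next
      case (step u w)
      then show ?case using leaf[of u w] by (auto simp: X_def)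
    qed
    then show False using y'(3) yX by auto
  qed
  have y'X: "y' \<notin> X" using leaf[of y' c] y' bc xy by (auto simp: X_def insert_commute)
  have "z \<notin> insert b X \<and> (y', z) \<in> (adj_rel Q)\<^sup>*"
    if "(y', z) \<in> (adj_rel T \<inter> {(u, v). u \<noteq> c \<and> v \<noteq> c})\<^sup>*" for z
    using that
  proof (induction rule: rtrancl_induct)
    case base
    show ?case using y'X y'b by simp
  next
    case (step u w)
    then have uw: "{u, w} \<in> T" "u \<noteq> c" "w \<noteq> c" "u \<noteq> b" "u \<notin> X" by auto
    then have "w \<noteq> b" by (auto simp: X_def insert_commute)
    moreover have "w \<notin> X" using leaf[of w u] uw by (auto simp: X_def insert_commute)
    moreover have "(u, w) \<in> adj_rel Q" using uw \<open>w \<noteq> b\<close> by (auto simp: Q_def)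
    ultimately show ?case using step.IH by (auto intro: rtrancl_into_rtrancl)
  qed
  then have walk: "(y', y) \<in> (adj_rel Q)\<^sup>*" using y'(3) by blast
  define F where "F = insert f T"
  have inF: "{b, c} \<in> F" "{b, x} \<in> F" "{c, y'} \<in> F" "{x, y} \<in> F"
    using bc bx y' by (auto simp: F_def f_def)
  have ne: "{b, c} \<noteq> {b, x}" "{b, c} \<noteq> {c, y'}" "{b, c} \<noteq> {x, y}" "{b, x} \<noteq> {c, y'}" "{b, x} \<noteq> {x, y}"
    "{c, y'} \<noteq> {x, y}"
    using xy bx y'b y' yX y by (auto simp: doubleton_eq_iff)
  have walkF: "(y', y) \<in> (adj_rel (F - {g}))\<^sup>*" "(y, y') \<in> (adj_rel (F - {g}))\<^sup>*" if "g \<notin> Q" for g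
  proof -
    have "adj_rel Q \<subseteq> adj_rel (F - {g})" using that by (auto simp: Q_def F_def)
    then show "(y', y) \<in> (adj_rel (F - {g}))\<^sup>*" using walk rtrancl_mono by blast
    then show "(y, y') \<in> (adj_rel (F - {g}))\<^sup>*" by (rule adj_rel_rtrancl_sym)
  qed
  have adjF: "(u, v) \<in> (adj_rel (F - {g}))\<^sup>*" "(v, u) \<in> (adj_rel (F - {g}))\<^sup>*" if "{u, v} \<in> F" "{u, v} \<noteq> g" for u v g
    using that by (auto simp: insert_commute intro!: r_into_rtrancl)
  have "(b, c) \<in> (adj_rel (F - {{b, c}}))\<^sup>*"
  proof -
    let ?S = "(adj_rel (F - {{b, c}}))\<^sup>*"
    have "(b, x) \<in> ?S" "(x, y) \<in> ?S" "(y, y') \<in> ?S" "(y', c) \<in> ?S"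
      using adjF inF ne walkF by (auto simp: Q_def)
    then show ?thesis by (meson rtrancl_trans)
  qed
  then have t1: "spanning_tree P (F - {{b, c}})"
    unfolding F_def using spanning_tree_exchange[OF P(1) tree bc f fT] by blast
  have "(b, x) \<in> (adj_rel (F - {{b, x}}))\<^sup>*"
  proof -
    let ?S = "(adj_rel (F - {{b, x}}))\<^sup>*"
    have "(b, c) \<in> ?S" "(y, x) \<in> ?S" "(y', y) \<in> ?S" "(c, y') \<in> ?S"
      using adjF inF ne walkF by (auto simp: Q_def)
    then show ?thesis by (meson rtrancl_trans)
  qed
  then have t2: "spanning_tree P (F - {{b, x}})"
    unfolding F_def using spanning_tree_exchange[OF P(1) tree bx(1) f fT] by blast
  have "(c, y') \<in> (adj_rel (F - {{c, y'}}))\<^sup>*"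
  proof -
    let ?S = "(adj_rel (F - {{c, y'}}))\<^sup>*"
    have "(c, b) \<in> ?S" "(b, x) \<in> ?S" "(x, y) \<in> ?S" "(y, y') \<in> ?S"
      using adjF inF ne walkF by (auto simp: Q_def)
    then show ?thesis by (meson rtrancl_trans)
  qed
  then have t3: "spanning_tree P (F - {{c, y'}})"
    unfolding F_def using spanning_tree_exchange[OF P(1) tree y'(1) f fT] by blast
  have fne: "f \<noteq> {b, c}" "f \<noteq> {b, x}" "f \<noteq> {c, y'}"
    using bc bx y' fT by auto
  define B where "B = F - {{b, c}}"
  have Beq: "B = insert f (T - {{b, c}})"
    using fne by (simp add: B_def F_def insert_Diff_if)
  have "\<forall>e\<in>B. \<forall>g\<in>B. \<not> crosses e g"
    unfolding Beq using clean f_cross by (intro no_crosses_insert[OF _ f]) blast+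
  then have BS: "B \<in> SSTs P" using t1 by (simp add: SSTs_iff B_def)
  have "sym_diff T B = {f, {b, c}}"
    using bc fT unfolding Beq by blast
  then have adj: "G_adjacent P T B"
    using TS BS fne(1) by (simp add: G_adjacent_def)
  have TB: "T \<union> B = F" using bc unfolding Beq F_def by blast
  have "card (U_clique P T B) \<noteq> 3"
  proof (cases "crosses f {b, c}")
    case True
    \<comment> \<open>No member contains both \<open>f\<close> and \<open>b c\<close>, so the
      omitted edge is one of these two.\<close>
    have "C \<in> {T, B}" if C: "C \<in> U_clique P T B" for C
    proof -
      have CS: "C \<in> SSTs P" "C \<subseteq> insert f T" using C TB by (auto simp: U_clique_def F_def)
      then obtain g where g: "g \<in> insert f T" "C = insert f T - {g}"
        using spanning_tree_subset_insert[OF P(1) tree _ _ fT] by (metis SSTs_iff)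
      have "f \<notin> C \<or> {b, c} \<notin> C" using CS(1) True by (auto simp: SSTs_iff)
      then have "g = f \<or> g = {b, c}" using g bc by blast
      then show ?thesis using g fT by (elim disjE) (simp_all add: B_def F_def)
    qed
    then have "card (U_clique P T B) \<le> card {T, B}" by (intro card_mono) auto
    also have "\<dots> \<le> 2" by (simp add: card_insert_if)
    finally show ?thesis by simp
  next
    case False
    then have "\<not> crosses f e" if "e \<in> T" for e using f_cross that by blast
    then have "\<forall>e\<in>F. \<forall>g\<in>F. \<not> crosses e g"
      unfolding F_def using clean by (intro no_crosses_insert[OF _ f]) blast+
    then have sub: "{T, B, F - {{b, x}}, F - {{c, y'}}} \<subseteq> U_clique P T B"
      using tree t1 t2 t3 TB unfolding U_clique_def SSTs_iff B_def by blast
    have "finite (Pow F)"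
      using finite_spanning_tree[OF P(1) tree] by (simp add: F_def)
    moreover have "U_clique P T B \<subseteq> Pow F"
      unfolding U_clique_def TB by blast
    ultimately have fin: "finite (U_clique P T B)"
      by (rule finite_subset[rotated])
    have in1: "f \<in> B" "f \<in> F - {{b, x}}" "f \<in> F - {{c, y'}}"
      using fne by (simp_all add: B_def F_def)
    have in2: "{b, c} \<in> F - {{b, x}}" "{b, c} \<in> F - {{c, y'}}" "{b, c} \<notin> B"
      using inF ne by (simp_all add: B_def)
    have in3: "{b, x} \<in> F - {{c, y'}}" using inF ne by simp
    have "T \<noteq> B" "T \<noteq> F - {{b, x}}" "T \<noteq> F - {{c, y'}}" "B \<noteq> F - {{b, x}}" "B \<noteq> F - {{c, y'}}"
      using in1 in2 fT by metis+
    moreover have "F - {{b, x}} \<noteq> F - {{c, y'}}" using in3 by blast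
    ultimately have "card {T, B, F - {{b, x}}, F - {{c, y'}}} = 4" by simp
    then show ?thesis
      using card_mono[OF fin sub] by linarith
  qed
  then show ?thesis using adj by blast
qed

theorem theorem4:
  fixes P :: "(real^2) set" and T :: "(real^2) set set"
  assumes "finite P"
    and "general_position P"
    and "card P \<ge> 3"
    and "T \<in> SSTs P"
  shows "is_star P T \<longleftrightarrow>
    (\<forall>A B. G_adjacent P A B \<and> T \<in> U_clique P A B \<longrightarrow> card (U_clique P A B) = 3)"
proof -
  have tree: "spanning_tree P T" using assms(4) by (simp add: SSTs_iff)
  show ?thesis
    using assms(1,3) tree
  proof (cases rule: spanning_tree_cases)
    case (center b)
    then show ?thesis
      using center_imp_is_star[OF assms(1,3) tree center] star_U_clique_card[OF assms(1) _ _ center]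
      by blast
  next
    case (broom b c x y)
    have "\<not> is_star P T"
      using tree by (intro broom_not_is_star[OF assms(1) _ broom(1-4)] broom(5)) (auto simp: spanning_tree_def)
    moreover obtain B where "G_adjacent P T B" "card (U_clique P T B) \<noteq> 3"
      using broom_bad_U_clique[OF assms(1,2,4) broom(1-4)] broom(5) by blast
    moreover have "T \<in> U_clique P T B" using assms(4) by (simp add: U_clique_def)
    ultimately show ?thesis by blast
  qed
qed

end
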